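(* Let $k\ge2$ and $n-2k\ge4$. For $\alpha,\beta,\gamma\in\mathbb{C}$ let $R(\mu_2,1)(\alpha,\beta,\gamma)$ be the $(n+1)$-dimensional Leibniz algebra over $\mathbb{C}$ with basis $\{e_1,\dots,e_{n-2k},f_1,\dots,f_{2k},x\}$ and multiplication table $$\begin{array}{ll} [e_i,e_1]=e_{i+1},&1\le i\le n-2k-1,\\ {}[e_1,f_1]=e_2+f_{k+1},&\\ {}[e_i,f_1]=e_{i+1},&2\le i\le n-2k-1,\\ {}[e_1,f_j]=f_{k+j},&2\le j\le k,\\ {}[e_1,x]=f_1+\alpha f_{k+1},&\\ {}[e_2,x]=e_2+f_{k+1},&\\ {}[e_i,x]=(i-1)e_i,&3\le i\le n-2k,\\ {}[f_i,x]=-[x,f_i]=f_i+f_{i+1},&1\le i\le k-1,\\ {}[f_k,x]=-[x,f_k]=f_k,&\\ {}[f_{k+1},x]=f_{k+2},&\\ {}[f_i,x]=f_i+f_{i+1},&k+2\le i\le 2k-1,\\ {}[f_{2k},x]=f_{2k},&\\ {}[x,e_1]=-f_1+\beta\sum_{i=1}^{k}(-1)^{i-1}f_{k+i},&\\ {}[x,x]=\gamma f_{k+1},& \end{array}$$ products not listed being zero. Then any algebra $R(\mu_2,1)(\alpha,\beta,\gamma)$ is isomorphic to one of the following pairwise non-isomorphic algebras: $$R(\mu_2,1)(0,0,0),\quad R(\mu_2,1)(0,0,1),\quad R(\mu_2,1)(0,1,\gamma),\quad R(\mu_2,1)(1,\beta,\gamma),\qquad \beta,\gamma\in\mathbb{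C}.$$
   Context: A (right) Leibniz algebra is a vector space $L$ over $\mathbb{C}$ with a bilinear bracket satisfying $[x,[y,z]]=[[x,y],z]-[[x,z],y]$ for all $x,y,z\in L$. An isomorphism is a bijective linear map preserving the bracket. Pairwise non-isomorphic means that distinct members of the displayed list (including distinct parameter values) are non-isomorphic. *)

theory Defs
  imports Complex_Main "HOL-Library.Function_Algebras"
begin

text \<open>A complex vector space with a bracket: a subset of an ambient additive group, a scalar
  multiplication and a binary operation, all of them relevant only on the carrier.\<close>

record 'a bracket_algebra =
  alg_carrier :: "'a set"
  alg_scale :: "complex \<Rightarrow> 'a \<Rightarrow> 'a"
  alg_bracket :: "'a \<Rightarrow> 'a \<Rightarrow> 'a"

definition leibniz_algebra :: "('a::ab_group_add) bracket_algebra \<Rightarrow> bool" where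
  "leibniz_algebra A \<longleftrightarrow>
     (let L = alg_carrier A; s = alg_scale A; br = alg_bracket A in
        vector_space s \<and> module.subspace s L \<and>
        (\<forall>x\<in>L. \<forall>y\<in>L. br x y \<in> L) \<and>
        (\<forall>x\<in>L. \<forall>y\<in>L. \<forall>z\<in>L. br (x + y) z = br x z + br y z \<and> br z (x + y) = br z x + br z y) \<and>
        (\<forall>c. \<forall>x\<in>L. \<forall>y\<in>L. br (s c x) y = s c (br x y) \<and> br x (s c y) = s c (br x y)) \<and>
        (\<forall>x\<in>L. \<forall>y\<in>L. \<forall>z\<in>L. br x (br y z) = br (br x y) z - br (br x z) y))"

definition algebra_iso ::
    "('a::ab_group_add) bracket_algebra \<Rightarrow> ('b::ab_group_add) bracket_algebra \<Rightarrow> ('a \<Rightarrow> 'b) \<Rightarrow> bool" where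
  "algebra_iso A B \<phi> \<longleftrightarrow>
     bij_betw \<phi> (alg_carrier A) (alg_carrier B) \<and>
     (\<forall>x\<in>alg_carrier A. \<forall>y\<in>alg_carrier A. \<phi> (x + y) = \<phi> x + \<phi> y) \<and>
     (\<forall>c. \<forall>x\<in>alg_carrier A. \<phi> (alg_scale A c x) = alg_scale B c (\<phi> x)) \<and>
     (\<forall>x\<in>alg_carrier A. \<forall>y\<in>alg_carrier A. \<phi> (alg_bracket A x y) = alg_bracket B (\<phi> x) (\<phi> y))"

definition isomorphic ::
    "('a::ab_group_add) bracket_algebra \<Rightarrow> ('b::ab_group_add) bracket_algebra \<Rightarrow> bool"
    (infix "\<cong>\<^sub>L" 50) where
  "A \<cong>\<^sub>L B \<longleftrightarrow> (\<exists>\<phi>. algebra_iso A B \<phi>)"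

text \<open>The algebras are realised on coordinate functions: \<open>BE i\<close>, \<open>BF j\<close>, \<open>BX\<close> are the indices
  of \<open>e\<^sub>i\<close>, \<open>f\<^sub>j\<close>, \<open>x\<close>, and only those in \<open>basis_index k n\<close> occur.  That the resulting
  algebra is an \<open>(n + 1)\<close>-dimensional Leibniz algebra with this basis and this table is
  proved in \<open>R_basis\<close>, \<open>R_mu2_1_bracket\<close> and \<open>leibniz_algebra_R_mu2_1\<close> below.\<close>

datatype basis = BE nat | BF nat | BX

definition basis_index :: "nat \<Rightarrow> nat \<Rightarrow> basis set" where
  "basis_index k n = BE ` {1..n - 2*k} \<union> BF ` {1..2*k} \<union> {BX}"

definition fscale :: "complex \<Rightarrow> ('b \<Rightarrow> complex) \<Rightarrow> 'b \<Rightarrow> complex" (infixr "*\<^sub>f" 75) where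
  "c *\<^sub>f v = (\<lambda>b. c * v b)"

definition unit_fun :: "'b \<Rightarrow> 'b \<Rightarrow> complex" where
  "unit_fun b = (\<lambda>c. if c = b then 1 else 0)"

abbreviation "evec i \<equiv> unit_fun (BE i)"
abbreviation "fvec j \<equiv> unit_fun (BF j)"
abbreviation "xvec \<equiv> unit_fun BX"

fun R_table :: "nat \<Rightarrow> nat \<Rightarrow> complex \<Rightarrow> complex \<Rightarrow> complex \<Rightarrow> basis \<Rightarrow> basis \<Rightarrow> (basis \<Rightarrow> complex)" where
  "R_table k n \<alpha> \<beta> \<gamma> (BE i) (BE j) =
     (if j = 1 \<and> 1 \<le> i \<and> i \<le> n - 2*k - 1 then evec (i + 1) else 0)"
| "R_table k n \<alpha> \<beta> \<gamma> (BE i) (BF j) =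
     (if i = 1 \<and> j = 1 then evec 2 + fvec (k + 1)
      else if j = 1 \<and> 2 \<le> i \<and> i \<le> n - 2*k - 1 then evec (i + 1)
      else if i = 1 \<and> 2 \<le> j \<and> j \<le> k then fvec (k + j)
      else 0)"
| "R_table k n \<alpha> \<beta> \<gamma> (BE i) BX =
     (if i = 1 then fvec 1 + \<alpha> *\<^sub>f fvec (k + 1)
      else if i = 2 then evec 2 + fvec (k + 1)
      else if 3 \<le> i \<and> i \<le> n - 2*k then of_nat (i - 1) *\<^sub>f evec i
      else 0)"
| "R_table k n \<alpha> \<beta> \<gamma> (BF i) (BE j) = 0"
| "R_table k n \<alpha> \<beta> \<gamma> (BF i) (BF j) = 0"
| "R_table k n \<alpha> \<beta> \<gamma> (BF i) BX =
     (if 1 \<le> i \<and> i \<le> k - 1 then fvec i + fvec (i + 1)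
      else if i = k then fvec k
      else if i = k + 1 then fvec (k + 2)
      else if k + 2 \<le> i \<and> i \<le> 2*k - 1 then fvec i + fvec (i + 1)
      else if i = 2*k then fvec (2*k)
      else 0)"
| "R_table k n \<alpha> \<beta> \<gamma> BX (BE i) =
     (if i = 1 then - fvec 1 + \<beta> *\<^sub>f (\<Sum>j=1..k. (-1)^(j - 1) *\<^sub>f fvec (k + j)) else 0)"
| "R_table k n \<alpha> \<beta> \<gamma> BX (BF i) =
     (if 1 \<le> i \<and> i \<le> k - 1 then - (fvec i + fvec (i + 1))
      else if i = k then - fvec k
      else 0)"
| "R_table k n \<alpha> \<beta> \<gamma> BX BX = \<gamma> *\<^sub>f fvec (k + 1)"

definition R_mu2_1 :: "nat \<Rightarrow> nat \<Rightarrow> complex \<times> complex \<times> complex \<Rightarrow> (basis \<Rightarrow> complex) bracket_algebra" where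
  "R_mu2_1 k n = (\<lambda>(\<alpha>, \<beta>, \<gamma>).
     \<lparr> alg_carrier = {v. \<forall>b. b \<notin> basis_index k n \<longrightarrow> v b = 0},
       alg_scale = (*\<^sub>f),
       alg_bracket = (\<lambda>u v. \<Sum>a\<in>basis_index k n. \<Sum>b\<in>basis_index k n.
                               (u a * v b) *\<^sub>f R_table k n \<alpha> \<beta> \<gamma> a b) \<rparr>)"

definition canonical_params :: "(complex \<times> complex \<times> complex) set" where
  "canonical_params =
     {(0, 0, 0), (0, 0, 1)} \<union> {(0, 1, \<gamma>) | \<gamma>. True} \<union> {(1, \<beta>, \<gamma>) | \<beta> \<gamma>. True}"


lemma vector_space_fscale: "vector_space ((*\<^sub>f) :: complex \<Rightarrow> ('b \<Rightarrow> complex) \<Rightarrow> _)"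
  by unfold_locales (auto simp: fscale_def fun_eq_iff algebra_simps)

interpretation fs: vector_space "(*\<^sub>f) :: complex \<Rightarrow> ('b \<Rightarrow> complex) \<Rightarrow> 'b \<Rightarrow> complex"
  by (rule vector_space_fscale)

lemma finite_basis_index: "finite (basis_index k n)"
  by (simp add: basis_index_def)

lemma card_basis_index:
  assumes "2*k \<le> n" shows "card (basis_index k n) = n + 1"
proof -
  have "card (BE ` {1..n - 2*k} \<union> BF ` {1..2*k}) = (n - 2*k) + 2*k"
    by (subst card_Un_disjoint) (auto simp: card_image inj_on_def)
  then show ?thesis using assms unfolding basis_index_def
    by (subst card_Un_disjoint) auto
qed

lemma sum_fun_apply: "(\<Sum>a\<in>A. g a) b = (\<Sum>a\<in>A. g a b)"
  by (induction A rule: infinite_finite_induct) auto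

lemma fun_expand:
  assumes "finite B" "\<And>b. b \<notin> B \<Longrightarrow> v b = 0"
  shows "v = (\<Sum>a\<in>B. v a *\<^sub>f unit_fun a)"
proof
  fix b
  have "(\<Sum>a\<in>B. v a * unit_fun a b) = (\<Sum>a\<in>B. if a = b then v a else 0)"
    by (rule sum.cong) (auto simp: unit_fun_def)
  then show "v b = (\<Sum>a\<in>B. v a *\<^sub>f unit_fun a) b"
    using assms by (simp add: sum_fun_apply fscale_def)
qed

lemma R_basis:
  assumes "2*k \<le> n"
  defines "U \<equiv> (unit_fun ` basis_index k n :: (basis \<Rightarrow> complex) set)"
  shows "\<not> fs.dependent U" and "fs.span U = alg_carrier (R_mu2_1 k n p)" and "card U = n + 1"
    and "fs.dim (alg_carrier (R_mu2_1 k n p)) = n + 1"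
proof -
  have inj: "inj_on unit_fun A" for A :: "basis set"
    by (auto simp: inj_on_def unit_fun_def fun_eq_iff)
  show card: "card U = n + 1"
    using assms by (simp add: card_image inj card_basis_index)
  have fin: "finite U" by (simp add: U_def finite_basis_index)
  show ind: "\<not> fs.dependent U"
    unfolding fs.dependent_finite[OF fin]
  proof safe
    fix w v assume v: "v \<in> U" "w v \<noteq> 0" and 0: "(\<Sum>v\<in>U. w v *\<^sub>f v) = 0"
    obtain b where b: "b \<in> basis_index k n" "v = unit_fun b" using v by (auto simp: U_def)
    have "0 = (\<Sum>v\<in>U. w v *\<^sub>f v) b" by (simp add: 0)
    also have "\<dots> = (\<Sum>a\<in>basis_index k n. w (unit_fun a) * unit_fun a b)"
      by (simp add: U_def sum.reindex inj sum_fun_apply fscale_def)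
    also have "\<dots> = (\<Sum>a\<in>basis_index k n. if a = b then w (unit_fun a) else 0)"
      by (rule sum.cong) (auto simp: unit_fun_def)
    also have "\<dots> = w v" using b by (simp add: finite_basis_index)
    finally show False using v by simp
  qed
  show sp: "fs.span U = alg_carrier (R_mu2_1 k n p)"
  proof
    have "fs.subspace (alg_carrier (R_mu2_1 k n p))"
      by (auto simp: fs.subspace_def R_mu2_1_def fscale_def split: prod.splits)
    moreover have "U \<subseteq> alg_carrier (R_mu2_1 k n p)"
      by (auto simp: U_def R_mu2_1_def unit_fun_def split: prod.splits)
    ultimately show "fs.span U \<subseteq> alg_carrier (R_mu2_1 k n p)" by (simp add: fs.span_minimal)
    show "alg_carrier (R_mu2_1 k n p) \<subseteq> fs.span U"
    proof
      fix v assume "v \<in> alg_carrier (R_mu2_1 k n p)"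
      then have "v = (\<Sum>a\<in>basis_index k n. v a *\<^sub>f unit_fun a)"
        by (intro fun_expand) (auto simp: finite_basis_index R_mu2_1_def split: prod.splits)
      also have "\<dots> \<in> fs.span U"
        by (intro fs.span_sum fs.span_scale fs.span_base) (auto simp: U_def)
      finally show "v \<in> fs.span U" .
    qed
  qed
  show "fs.dim (alg_carrier (R_mu2_1 k n p)) = n + 1"
    using fs.dim_span_eq_card_independent[OF ind] sp card by simp
qed

context
  fixes k n :: nat and \<alpha> \<beta> \<gamma> :: complex
begin

private abbreviation (input) "B \<equiv> basis_index k n"
private abbreviation (input) "T \<equiv> R_table k n \<alpha> \<beta> \<gamma>"

private definition "br u v = (\<Sum>a\<in>B. \<Sum>b\<in>B. (u a * v b) *\<^sub>f T a b)"

private lemma br_add: "br (u + v) w = br u w + br v w" "br w (u + v) = br w u + br w v"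
  by (simp_all add: br_def algebra_simps fs.scale_left_distrib sum.distrib)

private lemma br_scale: "br (c *\<^sub>f u) v = c *\<^sub>f br u v" "br u (c *\<^sub>f v) = c *\<^sub>f br u v"
  unfolding br_def fs.scale_sum_right fs.scale_scale
  by (intro sum.cong refl arg_cong2[where f = fscale]; simp add: fscale_def)+

private lemma br_zero: "br 0 u = 0" "br u 0 = 0"
  by (simp_all add: br_def)

private lemma br_minus: "br (- u) v = - br u v" "br v (- u) = - br v u"
  using br_scale(1)[of "-1" u v] br_scale(2)[of v "-1" u]
  by simp_all

private lemma br_sum: "br (sum g A) v = (\<Sum>a\<in>A. br (g a) v)" "br v (sum g A) = (\<Sum>a\<in>A. br v (g a))"
  using sum_comp_morphism[of "\<lambda>u. br u v" g A] sum_comp_morphism[of "br v" g A]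
  by (simp_all add: br_zero br_add comp_def)

private lemma br_unit:
  assumes "a \<in> B" "b \<in> B" shows "br (unit_fun a) (unit_fun b) = T a b"
proof -
  have "br (unit_fun a) (unit_fun b) = (\<Sum>c\<in>B. \<Sum>d\<in>B. if d = b then (if c = a then T c d else 0) else 0)"
    unfolding br_def by (intro sum.cong refl) (auto simp: unit_fun_def)
  also have "\<dots> = T a b" using assms by (simp add: finite_basis_index)
  finally show ?thesis .
qed

private lemma alternating_telescope:
  fixes G :: "nat \<Rightarrow> basis \<Rightarrow> complex"
  shows "(\<Sum>j=1..m. (-1)^(j - 1) *\<^sub>f (G j + G (j + 1))) = G 1 - (-1)^m *\<^sub>f G (m + 1)"
  by (rule nat_induct[of _ m]) (simp_all add: fun_eq_iff fscale_def sum_fun_apply algebra_simps)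

context
  assumes k: "k \<ge> 2" and n: "n - 2*k \<ge> 4"
begin

private lemma in_B [simp]:
  "BE i \<in> B \<longleftrightarrow> 1 \<le> i \<and> i \<le> n - 2*k" "BF i \<in> B \<longleftrightarrow> 1 \<le> i \<and> i \<le> 2*k" "BX \<in> B"
  by (auto simp: basis_index_def)

private definition "tail = (\<Sum>j=1..k. (-1)^(j - 1) *\<^sub>f fvec (k + j))"

private lemma tail_fold: "(\<Sum>j=Suc 0..k. (-1)^(j - Suc 0) *\<^sub>f fvec (k + j)) = tail"
  by (simp add: tail_def)

private lemma br_tail_x: "br tail xvec = 0"
proof -
  define G where "G j = (if 2 \<le> j \<and> j \<le> k then fvec (k + j) else 0)" for j
  have "br tail xvec = (\<Sum>j=1..k. (-1)^(j - 1) *\<^sub>f br (fvec (k + j)) xvec)"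
    by (simp only: tail_def br_sum br_scale)
  also have "\<dots> = (\<Sum>j=1..k. (-1)^(j - 1) *\<^sub>f (G j + G (j + 1)))"
    using k by (intro sum.cong refl arg_cong2[where f = fscale])
      (auto simp: br_unit G_def mult_2 intro!: arg_cong[where f = unit_fun])
  also have "\<dots> = 0" unfolding alternating_telescope by (simp add: G_def)
  finally show ?thesis .
qed

private lemma br_tail:
  "Suc 0 \<le> i \<Longrightarrow> i \<le> n - 2*k \<Longrightarrow> br (evec i) tail = 0"
  "Suc 0 \<le> i \<Longrightarrow> i \<le> 2*k \<Longrightarrow> br (fvec i) tail = 0"
  "br xvec tail = 0"
  "Suc 0 \<le> i \<Longrightarrow> i \<le> n - 2*k \<Longrightarrow> br tail (evec i) = 0"
  "Suc 0 \<le> i \<Longrightarrow> i \<le> 2*k \<Longrightarrow> br tail (fvec i) = 0"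
  unfolding tail_def br_sum br_scale by (auto intro!: sum.neutral simp: br_unit)

private lemma br_diff: "br (u - v) w = br u w - br v w" "br w (u - v) = br w u - br w v"
  using br_add(1)[of u "- v" w] br_add(2)[of w u "- v"] by (simp_all add: br_minus)

private lemma fscale_numeral: "numeral q *\<^sub>f v = numeral q * v"
  by (simp add: fscale_def fun_eq_iff)

private lemmas br_simps = br_unit br_add br_diff br_scale br_minus br_zero tail_fold br_tail br_tail_x
  numeral_3_eq_3 fs.scale_right_distrib fs.scale_left_diff_distrib fs.scale_right_diff_distrib
  fscale_numeral mult_2[where 'a = nat]

private lemma br_x_high: "k < i \<Longrightarrow> i \<le> 2*k \<Longrightarrow> br xvec (fvec i) = 0"
  by (auto simp: br_unit)

private lemma EEE: assumes "1 \<le> h \<and> h \<le> n - 2*k" "1 \<le> i \<and> i \<le> n - 2*k" "1 \<le> j \<and> j \<le> n - 2*k" shows "br (evec h) (br (evec i) (evec j)) = br (br (evec h) (evec i)) (evec j) - br (br (evec h) (evec j)) (evec i)"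
  using k n assms by (auto simp: br_simps)

private lemma EEF: assumes "1 \<le> h \<and> h \<le> n - 2*k" "1 \<le> i \<and> i \<le> n - 2*k" "1 \<le> j \<and> j \<le> 2*k" shows "br (evec h) (br (evec i) (fvec j)) = br (br (evec h) (evec i)) (fvec j) - br (br (evec h) (fvec j)) (evec i)"
  using k n assms by (auto simp: br_simps)

private lemma EEX: assumes "1 \<le> h \<and> h \<le> n - 2*k" "1 \<le> i \<and> i \<le> n - 2*k" shows "br (evec h) (br (evec i) xvec) = br (br (evec h) (evec i)) xvec - br (br (evec h) xvec) (evec i)"
  using k n assms by (auto simp: br_simps)

private lemma EFE: assumes "1 \<le> h \<and> h \<le> n - 2*k" "1 \<le> i \<and> i \<le> 2*k" "1 \<le> j \<and> j \<le> n - 2*k" shows "br (evec h) (br (fvec i) (evec j)) = br (br (evec h) (fvec i)) (evec j) - br (br (evec h) (evec j)) (fvec i)"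
  using k n assms by (auto simp: br_simps)

private lemma EFF: assumes "1 \<le> h \<and> h \<le> n - 2*k" "1 \<le> i \<and> i \<le> 2*k" "1 \<le> j \<and> j \<le> 2*k" shows "br (evec h) (br (fvec i) (fvec j)) = br (br (evec h) (fvec i)) (fvec j) - br (br (evec h) (fvec j)) (fvec i)"
  using k n assms by (auto simp: br_simps)

private lemma EFX: assumes "1 \<le> h \<and> h \<le> n - 2*k" "1 \<le> i \<and> i \<le> 2*k" shows "br (evec h) (br (fvec i) xvec) = br (br (evec h) (fvec i)) xvec - br (br (evec h) xvec) (fvec i)"
  using k n assms by (auto simp: br_simps)

private lemma EXE: assumes "1 \<le> h \<and> h \<le> n - 2*k" "1 \<le> j \<and> j \<le> n - 2*k" shows "br (evec h) (br xvec (evec j)) = br (br (evec h) xvec) (evec j) - br (br (evec h) (evec j)) xvec"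
  using k n assms by (auto simp: br_simps)

private lemma EXF: assumes "1 \<le> h \<and> h \<le> n - 2*k" "1 \<le> j \<and> j \<le> 2*k" shows "br (evec h) (br xvec (fvec j)) = br (br (evec h) xvec) (fvec j) - br (br (evec h) (fvec j)) xvec"
  using k n assms by (auto simp: br_simps)

private lemma EXX: assumes "1 \<le> h \<and> h \<le> n - 2*k" shows "br (evec h) (br xvec xvec) = br (br (evec h) xvec) xvec - br (br (evec h) xvec) xvec"
  using k n assms by (auto simp: br_simps)

private lemma FEE: assumes "1 \<le> h \<and> h \<le> 2*k" "1 \<le> i \<and> i \<le> n - 2*k" "1 \<le> j \<and> j \<le> n - 2*k" shows "br (fvec h) (br (evec i) (evec j)) = br (br (fvec h) (evec i)) (evec j) - br (br (fvec h) (evec j)) (evec i)"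
  using k n assms by (auto simp: br_simps)

private lemma FEF: assumes "1 \<le> h \<and> h \<le> 2*k" "1 \<le> i \<and> i \<le> n - 2*k" "1 \<le> j \<and> j \<le> 2*k" shows "br (fvec h) (br (evec i) (fvec j)) = br (br (fvec h) (evec i)) (fvec j) - br (br (fvec h) (fvec j)) (evec i)"
  using k n assms by (auto simp: br_simps)

private lemma FEX: assumes "1 \<le> h \<and> h \<le> 2*k" "1 \<le> i \<and> i \<le> n - 2*k" shows "br (fvec h) (br (evec i) xvec) = br (br (fvec h) (evec i)) xvec - br (br (fvec h) xvec) (evec i)"
  using k n assms by (auto simp: br_simps)

private lemma FFE: assumes "1 \<le> h \<and> h \<le> 2*k" "1 \<le> i \<and> i \<le> 2*k" "1 \<le> j \<and> j \<le> n - 2*k" shows "br (fvec h) (br (fvec i) (evec j)) = br (br (fvec h) (fvec i)) (evec j) - br (br (fvec h) (evec j)) (fvec i)"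
  using k n assms by (auto simp: br_simps)

private lemma FFF: assumes "1 \<le> h \<and> h \<le> 2*k" "1 \<le> i \<and> i \<le> 2*k" "1 \<le> j \<and> j \<le> 2*k" shows "br (fvec h) (br (fvec i) (fvec j)) = br (br (fvec h) (fvec i)) (fvec j) - br (br (fvec h) (fvec j)) (fvec i)"
  using k n assms by (auto simp: br_simps)

private lemma FFX: assumes "1 \<le> h \<and> h \<le> 2*k" "1 \<le> i \<and> i \<le> 2*k" shows "br (fvec h) (br (fvec i) xvec) = br (br (fvec h) (fvec i)) xvec - br (br (fvec h) xvec) (fvec i)"
  using k n assms by (auto simp: br_simps)

private lemma FXE: assumes "1 \<le> h \<and> h \<le> 2*k" "1 \<le> j \<and> j \<le> n - 2*k" shows "br (fvec h) (br xvec (evec j)) = br (br (fvec h) xvec) (evec j) - br (br (fvec h) (evec j)) xvec"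
  using k n assms by (auto simp: br_simps)

private lemma FXF: assumes "1 \<le> h \<and> h \<le> 2*k" "1 \<le> j \<and> j \<le> 2*k" shows "br (fvec h) (br xvec (fvec j)) = br (br (fvec h) xvec) (fvec j) - br (br (fvec h) (fvec j)) xvec"
  using k n assms by (auto simp: br_simps)

private lemma FXX: assumes "1 \<le> h \<and> h \<le> 2*k" shows "br (fvec h) (br xvec xvec) = br (br (fvec h) xvec) xvec - br (br (fvec h) xvec) xvec"
  using k n assms by (auto simp: br_simps)

private lemma XEE: assumes "1 \<le> i \<and> i \<le> n - 2*k" "1 \<le> j \<and> j \<le> n - 2*k" shows "br xvec (br (evec i) (evec j)) = br (br xvec (evec i)) (evec j) - br (br xvec (evec j)) (evec i)"
  using k n assms by (auto simp: br_simps)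

private lemma XEF: assumes "1 \<le> i \<and> i \<le> n - 2*k" "1 \<le> j \<and> j \<le> 2*k" shows "br xvec (br (evec i) (fvec j)) = br (br xvec (evec i)) (fvec j) - br (br xvec (fvec j)) (evec i)"
  using k n assms by (auto simp: br_simps)

private lemma XEX: assumes "1 \<le> i \<and> i \<le> n - 2*k" shows "br xvec (br (evec i) xvec) = br (br xvec (evec i)) xvec - br (br xvec xvec) (evec i)"
  using k n assms by (auto simp: br_simps)

private lemma XFE: assumes "1 \<le> i \<and> i \<le> 2*k" "1 \<le> j \<and> j \<le> n - 2*k" shows "br xvec (br (fvec i) (evec j)) = br (br xvec (fvec i)) (evec j) - br (br xvec (evec j)) (fvec i)"
  using k n assms by (auto simp: br_simps)

private lemma XFF: assumes "1 \<le> i \<and> i \<le> 2*k" "1 \<le> j \<and> j \<le> 2*k" shows "br xvec (br (fvec i) (fvec j)) = br (br xvec (fvec i)) (fvec j) - br (br xvec (fvec j)) (fvec i)"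
  using k n assms by (auto simp: br_simps)

private lemma XFX: assumes "1 \<le> i \<and> i \<le> 2*k" shows "br xvec (br (fvec i) xvec) = br (br xvec (fvec i)) xvec - br (br xvec xvec) (fvec i)"
proof -
  have "br xvec (br (fvec i) xvec) = br (br xvec (fvec i)) xvec"
  proof (cases "k < i")
    case True
    then have "br xvec (br (fvec i) xvec) = 0"
      using k assms by (simp add: br_unit br_add br_zero br_x_high split del: if_split cong: if_cong)
        (auto simp: br_add br_zero br_x_high)
    then show ?thesis using True assms by (simp add: br_x_high br_zero)
  next
    case False
    then show ?thesis using k assms by (auto simp: br_simps)
  qed
  moreover have "br (br xvec xvec) (fvec i) = 0"
    using k assms by (simp add: br_unit br_scale)
  ultimately show ?thesis by simp
qed

private lemma XXE: assumes "1 \<le> j \<and> j \<le> n - 2*k" shows "br xvec (br xvec (evec j)) = br (br xvec xvec) (evec j) - br (br xvec (evec j)) xvec"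
  using k n assms by (auto simp: br_simps)

private lemma XXF: assumes "1 \<le> j \<and> j \<le> 2*k" shows "br xvec (br xvec (fvec j)) = br (br xvec xvec) (fvec j) - br (br xvec (fvec j)) xvec"
  using k n assms by (auto simp: br_simps)

private lemma XXX: shows "br xvec (br xvec xvec) = br (br xvec xvec) xvec - br (br xvec xvec) xvec"
  using k n  by (auto simp: br_simps)

private lemma leibniz_unit:
  assumes "a \<in> B" "b \<in> B" "c \<in> B"
  shows "br (unit_fun a) (br (unit_fun b) (unit_fun c)) =
         br (br (unit_fun a) (unit_fun b)) (unit_fun c) - br (br (unit_fun a) (unit_fun c)) (unit_fun b)"
  using assms
  by (cases a; cases b; cases c;
      simp add: EEE EEF EEX EFE EFF EFX EXE EXF EXX FEE FEF FEX FFE FFF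
        FFX FXE FXF FXX XEE XEF XEX XFE XFF XFX XXE XXF XXX)

private lemma leibniz_br:
  assumes "\<And>b. b \<notin> B \<Longrightarrow> u b = 0" "\<And>b. b \<notin> B \<Longrightarrow> v b = 0" "\<And>b. b \<notin> B \<Longrightarrow> w b = 0"
  shows "br u (br v w) = br (br u v) w - br (br u w) v"
proof -
  define u' v' w' where "u' = (\<Sum>a\<in>B. u a *\<^sub>f unit_fun a)" and "v' = (\<Sum>a\<in>B. v a *\<^sub>f unit_fun a)"
    and "w' = (\<Sum>a\<in>B. w a *\<^sub>f unit_fun a)"
  have 1: "br (unit_fun a) (br (unit_fun b) w') = br (br (unit_fun a) (unit_fun b)) w' - br (br (unit_fun a) w') (unit_fun b)"
    if "a \<in> B" "b \<in> B" for a b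
    unfolding w'_def br_sum br_scale
    by (simp add: leibniz_unit that fs.scale_right_diff_distrib sum_subtractf)
  have 2: "br (unit_fun a) (br v' w') = br (br (unit_fun a) v') w' - br (br (unit_fun a) w') v'"
    if "a \<in> B" for a
    unfolding v'_def br_sum br_scale
    by (simp add: 1 that fs.scale_right_diff_distrib sum_subtractf)
  have "br u' (br v' w') = br (br u' v') w' - br (br u' w') v'"
    unfolding u'_def br_sum br_scale
    by (simp add: 2 fs.scale_right_diff_distrib sum_subtractf)
  then show ?thesis
    using fun_expand[of B u] fun_expand[of B v] fun_expand[of B w] assms
    by (simp add: u'_def v'_def w'_def finite_basis_index)
qed

private lemma T_support:
  assumes "a \<in> B" "b \<in> B" "c \<notin> B" shows "T a b c = 0"
proof -
  have off: "unit_fun d c = 0" if "d \<in> B" for d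
    using that assms(3) by (auto simp: unit_fun_def)
  obtain m where m: "n - 2*k = m" "m \<ge> 4" using n by blast
  show ?thesis
    using assms(1,2) k m(2)
    by (cases a; cases b; simp add: off fscale_def sum_fun_apply m(1) split del: if_split;
        auto simp: off fscale_def sum_fun_apply m(1))
qed

lemma R_mu2_1_bracket:
  "a \<in> B \<Longrightarrow> b \<in> B \<Longrightarrow>
     alg_bracket (R_mu2_1 k n (\<alpha>, \<beta>, \<gamma>)) (unit_fun a) (unit_fun b) = T a b"
  using br_unit[of a b] by (simp add: R_mu2_1_def br_def)

lemma leibniz_algebra_R_mu2_1: "leibniz_algebra (R_mu2_1 k n (\<alpha>, \<beta>, \<gamma>))"
proof -
  have br: "alg_bracket (R_mu2_1 k n (\<alpha>, \<beta>, \<gamma>)) = br"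
    by (intro ext) (simp add: R_mu2_1_def br_def)
  have "br u v c = 0" if "c \<notin> B" for u v c
    using that unfolding br_def by (simp add: sum_fun_apply fscale_def T_support)
  then show ?thesis
    using leibniz_br unfolding leibniz_algebra_def Let_def br
    by (simp add: R_mu2_1_def vector_space_fscale fs.subspace_def br_add br_scale)
       (simp add: fscale_def)
qed

end

end

end

theory Submission
  imports Defs
begin

text \<open>The parameters \<open>(\<alpha>, \<beta>, \<gamma>)\<close> matter only up to \<open>(c \<alpha>, c \<beta>, c\<^sup>2 \<gamma>)\<close> with \<open>c \<noteq> 0\<close>, and
  \<open>canonical_params\<close> contains exactly one point of each orbit of this action.

  The reason becomes visible in the weight decomposition for right multiplication by \<open>x\<close>.  Put
  \<open>E = e\<^sub>1 - f\<^sub>1 + f\<^sub>2 - \<dots>\<close> and \<open>h = f\<^sub>k\<^sub>+\<^sub>1 - f\<^sub>k\<^sub>+\<^sub>2 + \<dots>\<close>.  Up to a multiple of a combination of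
  \<open>f\<^sub>k\<^sub>+\<^sub>2, f\<^sub>k\<^sub>+\<^sub>3, \<dots>\<close> that has to be added to \<open>E\<close> and to \<open>x\<close>, the weight zero part is spanned by
  \<open>E\<close>, \<open>x\<close> and the central element \<open>h\<close>, with products
  \<open>[E, E] = -h\<close>, \<open>[E, x] = \<alpha> h\<close>, \<open>[x, E] = \<beta> h\<close>, \<open>[x, x] = \<gamma> h\<close>,
  and the parts of positive weight do not see the parameters.  So multiplying \<open>E\<close> by \<open>c\<close> and
  \<open>h\<close> by \<open>c\<^sup>2\<close>, and correcting the other vectors accordingly, gives an isomorphism onto the algebra
  with rescaled parameters (\<open>isomorphic_rescale\<close>).

  Conversely, the positive weights span an ideal, and modulo this ideal the displayed products
  are a bilinear form on the plane of \<open>E\<close> and \<open>x\<close> with values in the line of \<open>h\<close>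
  (\<open>eta_bracket\<close>).  An isomorphism transports this form.  A general change of basis of the plane
  would mix the parameters, but an isomorphism cannot induce one: as the \<open>f\<^sub>j\<close> with \<open>j \<le> k\<close>
  have weight one, are killed by right multiplication with \<open>e\<^sub>1\<close>, anticommute with \<open>x\<close> and have
  square zero, the induced map of the plane is \<open>E \<mapsto> c E\<close>, \<open>x \<mapsto> x\<close> (\<open>img_coords\<close>).  Comparing the two
  forms then gives \<open>iso_params\<close>.\<close>

section \<open>The bracket as a bilinear operation\<close>

abbreviation R_bracket ::
    "nat \<Rightarrow> nat \<Rightarrow> complex \<times> complex \<times> complex \<Rightarrow> (basis \<Rightarrow> complex) \<Rightarrow> (basis \<Rightarrow> complex) \<Rightarrow> basis \<Rightarrow> complex" where
  "R_bracket k n p \<equiv> alg_bracket (R_mu2_1 k n p)"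

lemma R_bracket_eq:
  "R_bracket k n (\<alpha>, \<beta>, \<gamma>) u v =
     (\<Sum>a\<in>basis_index k n. \<Sum>b\<in>basis_index k n. (u a * v b) *\<^sub>f R_table k n \<alpha> \<beta> \<gamma> a b)"
  by (simp add: R_mu2_1_def)

lemma R_bracket_add:
  "R_bracket k n p (u + v) w = R_bracket k n p u w + R_bracket k n p v w"
  "R_bracket k n p w (u + v) = R_bracket k n p w u + R_bracket k n p w v"
  by (cases p; simp add: R_bracket_eq algebra_simps fs.scale_left_distrib sum.distrib)+

lemma R_bracket_scale:
  "R_bracket k n p (c *\<^sub>f u) v = c *\<^sub>f R_bracket k n p u v"
  "R_bracket k n p u (c *\<^sub>f v) = c *\<^sub>f R_bracket k n p u v"
  by (cases p; simp only: R_bracket_eq fs.scale_sum_right fs.scale_scale;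
      intro sum.cong refl arg_cong2[where f = fscale]; simp add: fscale_def)+

lemma R_bracket_zero: "R_bracket k n p 0 u = 0" "R_bracket k n p u 0 = 0"
  by (cases p; simp add: R_bracket_eq)+

lemma R_bracket_minus:
  "R_bracket k n p (- u) v = - R_bracket k n p u v" "R_bracket k n p v (- u) = - R_bracket k n p v u"
  using R_bracket_scale(1)[of k n p "-1" u v] R_bracket_scale(2)[of k n p v "-1" u] by simp_all

lemma R_bracket_diff:
  "R_bracket k n p (u - v) w = R_bracket k n p u w - R_bracket k n p v w"
  "R_bracket k n p w (u - v) = R_bracket k n p w u - R_bracket k n p w v"
  using R_bracket_add(1)[of k n p u "- v" w] R_bracket_add(2)[of k n p w u "- v"]
  by (simp_all add: R_bracket_minus)

lemma R_bracket_sum: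
  "R_bracket k n p (sum g A) v = (\<Sum>a\<in>A. R_bracket k n p (g a) v)"
  "R_bracket k n p v (sum g A) = (\<Sum>a\<in>A. R_bracket k n p v (g a))"
  using sum_comp_morphism[of "\<lambda>u. R_bracket k n p u v" g A]
    sum_comp_morphism[of "R_bracket k n p v" g A]
  by (simp_all add: R_bracket_zero R_bracket_add comp_def)

lemma alg_carrier_R:
  "alg_carrier (R_mu2_1 k n p) = {v. \<forall>b. b \<notin> basis_index k n \<longrightarrow> v b = 0}"
  by (cases p) (simp add: R_mu2_1_def)

lemma alg_scale_R [simp]: "alg_scale (R_mu2_1 k n p) = (*\<^sub>f)"
  by (cases p) (simp add: R_mu2_1_def)

lemma R_bracket_coeff:
  "R_bracket k n (\<alpha>, \<beta>, \<gamma>) u v c =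
     (\<Sum>a\<in>basis_index k n. \<Sum>b\<in>basis_index k n. u a * v b * R_table k n \<alpha> \<beta> \<gamma> a b c)"
  by (simp add: R_bracket_eq sum_fun_apply fscale_def)

lemma alternating_telescope:
  fixes g :: "nat \<Rightarrow> 'b \<Rightarrow> complex"
  shows "(\<Sum>j=1..m. (-1)^(j - 1) *\<^sub>f (g j + g (j + 1))) = g 1 - (-1)^m *\<^sub>f g (m + 1)"
  by (induction m) (simp_all add: fun_eq_iff fscale_def sum_fun_apply algebra_simps)

text \<open>Right multiplication by \<open>x\<close> acts like \<open>1 + J\<close> for a shift \<open>J\<close>.  An alternating sum is
  \<open>(1 + J)\<^sup>-\<^sup>1\<close> of its first term, and the coefficients \<open>(-1)\<^sup>j (j - 1)\<close> come from
  \<open>(1 + J)\<^sup>-\<^sup>2 = 1 - 2 J + 3 J\<^sup>2 - \<dots>\<close>, so that \<open>1 + J\<close> turns them into an alternating sum.\<close>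

lemma weighted_alternating_telescope:
  fixes g :: "nat \<Rightarrow> 'b \<Rightarrow> complex"
  shows "(\<Sum>j=1..m. ((-1)^j * (of_nat j - 1)) *\<^sub>f (g j + g (j + 1))) =
    g 1 - (\<Sum>j=1..m. (-1)^(j - 1) *\<^sub>f g j) + ((-1)^m * (of_nat m - 1)) *\<^sub>f g (m + 1)"
  by (induction m) (simp_all add: fun_eq_iff fscale_def sum_fun_apply algebra_simps)

lemma sum_at_pair:
  assumes "finite B" "a0 \<in> B" "b0 \<in> B"
  shows "(\<Sum>a\<in>B. \<Sum>b\<in>B. u a * v b * (if a = a0 \<and> b = b0 then t else 0)) = u a0 * v b0 * (t::complex)"
proof -
  have "(\<Sum>a\<in>B. \<Sum>b\<in>B. u a * v b * (if a = a0 \<and> b = b0 then t else 0)) =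
        (\<Sum>a\<in>B. \<Sum>b\<in>B. if b = b0 then (if a = a0 then u a * v b * t else 0) else 0)"
    by (intro sum.cong refl) auto
  also have "\<dots> = u a0 * v b0 * t" using assms by simp
  finally show ?thesis .
qed

context
  fixes k n :: nat
  assumes k: "k \<ge> 2" and n: "n - 2*k \<ge> 4"
begin

lemma in_basis_index:
  "BE i \<in> basis_index k n \<longleftrightarrow> 1 \<le> i \<and> i \<le> n - 2*k"
  "BF i \<in> basis_index k n \<longleftrightarrow> 1 \<le> i \<and> i \<le> 2*k" "BX \<in> basis_index k n"
  by (auto simp: basis_index_def)

lemma unit_in_carrier: "a \<in> basis_index k n \<Longrightarrow> unit_fun a \<in> alg_carrier (R_mu2_1 k n p)"
  by (auto simp: alg_carrier_R unit_fun_def)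

lemma carrier_add_scale:
  "u \<in> alg_carrier (R_mu2_1 k n p) \<Longrightarrow> v \<in> alg_carrier (R_mu2_1 k n p) \<Longrightarrow>
     u + v \<in> alg_carrier (R_mu2_1 k n p)"
  "u \<in> alg_carrier (R_mu2_1 k n p) \<Longrightarrow> c *\<^sub>f u \<in> alg_carrier (R_mu2_1 k n p)"
  by (auto simp: alg_carrier_R fscale_def)

section \<open>Rescaling the parameters\<close>

text \<open>In the overview \<open>f_alt\<close> is \<open>e\<^sub>1 - E\<close> and \<open>f_tail\<close> is the central element \<open>h\<close>.  The vector
  \<open>f_ramp\<close>, which is \<open>f\<^sub>k\<^sub>+\<^sub>2 - 2 f\<^sub>k\<^sub>+\<^sub>3 + 3 f\<^sub>k\<^sub>+\<^sub>4 - \<dots>\<close>, solves \<open>[f_ramp, x] = f\<^sub>k\<^sub>+\<^sub>1 - h\<close>; subtracting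
  multiples of it replaces \<open>f\<^sub>k\<^sub>+\<^sub>1\<close> by \<open>h\<close> in the products \<open>[E, x]\<close> and \<open>[x, x]\<close>.\<close>

definition f_alt :: "basis \<Rightarrow> complex" where
  "f_alt = (\<Sum>j=1..k. (-1)^(j - 1) *\<^sub>f fvec j)"

definition f_tail :: "basis \<Rightarrow> complex" where
  "f_tail = (\<Sum>j=1..k. (-1)^(j - 1) *\<^sub>f fvec (k + j))"

definition f_ramp :: "basis \<Rightarrow> complex" where
  "f_ramp = (\<Sum>j=1..k. ((-1)^j * (of_nat j - 1)) *\<^sub>f fvec (k + j))"

lemma fvec_sum_support:
  "(\<Sum>j\<in>J. c j *\<^sub>f fvec (g j)) b \<noteq> 0 \<Longrightarrow> \<exists>j\<in>J. b = BF (g j)"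
proof (rule ccontr)
  assume nz: "(\<Sum>j\<in>J. c j *\<^sub>f fvec (g j)) b \<noteq> 0" and "\<not> (\<exists>j\<in>J. b = BF (g j))"
  then have "(\<Sum>j\<in>J. c j *\<^sub>f fvec (g j)) b = 0"
    unfolding sum_fun_apply by (intro sum.neutral) (auto simp: fscale_def unit_fun_def)
  with nz show False by contradiction
qed

lemma f_support:
  "f_alt b \<noteq> 0 \<Longrightarrow> \<exists>j. 1 \<le> j \<and> j \<le> k \<and> b = BF j"
  "f_tail b \<noteq> 0 \<Longrightarrow> \<exists>j. k < j \<and> j \<le> 2 * k \<and> b = BF j"
  "f_ramp b \<noteq> 0 \<Longrightarrow> \<exists>j. k < j \<and> j \<le> 2 * k \<and> b = BF j"
  unfolding f_alt_def f_tail_def f_ramp_def by (drule fvec_sum_support; force)+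

lemma f_zero [simp]: "f_alt (BE i) = 0" "f_tail (BE i) = 0" "f_ramp (BE i) = 0"
  "f_alt BX = 0" "f_tail BX = 0" "f_ramp BX = 0"
  using f_support by blast+

context
  fixes \<alpha> \<beta> \<gamma> :: complex
begin

abbreviation (input) br where "br \<equiv> R_bracket k n (\<alpha>, \<beta>, \<gamma>)"

text \<open>Only the columns of \<open>e\<^sub>1\<close>, \<open>f\<^sub>1, \<dots>, f\<^sub>k\<close> and \<open>x\<close> of the multiplication table are nonzero.\<close>

lemma right_annihilator:
  assumes "\<And>b. v b \<noteq> 0 \<Longrightarrow> (\<exists>j. j \<noteq> 1 \<and> b = BE j) \<or> (\<exists>j>k. b = BF j)"
  shows "br u v = 0"
proof -
  have "v b = 0 \<or> R_table k n \<alpha> \<beta> \<gamma> a b = 0" for a b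
    using assms[of b] k by (cases "v b = 0"; cases a) auto
  then show ?thesis unfolding R_bracket_eq by (intro sum.neutral ballI) (metis fs.scale_zero_left fs.scale_zero_right mult_zero_right)
qed

text \<open>The \<open>f\<^sub>j\<close> multiply nontrivially only with \<open>x\<close> from the right.\<close>

lemma left_annihilator:
  assumes "\<And>b. u b \<noteq> 0 \<Longrightarrow> (\<exists>j. b = BF j)" "v BX = 0"
  shows "br u v = 0"
proof -
  have "u a * v b = 0 \<or> R_table k n \<alpha> \<beta> \<gamma> a b = 0" for a b
    using assms(1)[of a] assms(2) by (cases b; cases "u a = 0") auto
  then show ?thesis unfolding R_bracket_eq by (intro sum.neutral ballI) (metis fs.scale_zero_left fs.scale_zero_right)
qed

lemma right_zero: "br u f_tail = 0" "br u f_ramp = 0"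
  "j \<noteq> 1 \<Longrightarrow> br u (evec j) = 0" "j > k \<Longrightarrow> br u (fvec j) = 0"
  by (rule right_annihilator, (auto dest: f_support simp: unit_fun_def split: if_splits)[1])+

lemma left_zero: "v BX = 0 \<Longrightarrow> br f_alt v = 0" "v BX = 0 \<Longrightarrow> br f_tail v = 0"
  "v BX = 0 \<Longrightarrow> br f_ramp v = 0" "v BX = 0 \<Longrightarrow> br (fvec j) v = 0"
  by (rule left_annihilator, (auto dest: f_support simp: unit_fun_def split: if_splits)[2])+

lemma br_unit: "a \<in> basis_index k n \<Longrightarrow> b \<in> basis_index k n \<Longrightarrow>
  br (unit_fun a) (unit_fun b) = R_table k n \<alpha> \<beta> \<gamma> a b"
  by (rule R_mu2_1_bracket[OF k n])

lemma f_alt_x: "br f_alt xvec = fvec 1"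
proof -
  define g :: "nat \<Rightarrow> basis \<Rightarrow> complex" where "g j = (if j \<le> k then fvec j else 0)" for j
  have "br f_alt xvec = (\<Sum>j=1..k. (-1)^(j - 1) *\<^sub>f (g j + g (j + 1)))"
    unfolding f_alt_def R_bracket_sum R_bracket_scale
    by (intro sum.cong refl arg_cong2[where f = fscale]) (auto simp: g_def br_unit in_basis_index)
  also have "\<dots> = fvec 1" unfolding alternating_telescope using k by (simp add: g_def)
  finally show ?thesis .
qed

lemma x_f_alt: "br xvec f_alt = - fvec 1"
proof -
  define g :: "nat \<Rightarrow> basis \<Rightarrow> complex" where "g j = (if j \<le> k then - fvec j else 0)" for j
  have "br xvec f_alt = (\<Sum>j=1..k. (-1)^(j - 1) *\<^sub>f (g j + g (j + 1)))"
    unfolding f_alt_def R_bracket_sum R_bracket_scale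
    by (intro sum.cong refl arg_cong2[where f = fscale]) (auto simp: g_def br_unit in_basis_index)
  also have "\<dots> = - fvec 1" unfolding alternating_telescope using k by (simp add: g_def)
  finally show ?thesis .
qed

lemma f_ramp_x: "br f_ramp xvec = fvec (k + 1) - f_tail"
proof -
  define g :: "nat \<Rightarrow> basis \<Rightarrow> complex" where "g j = (if j \<le> k then fvec (k + j) else 0)" for j
  have "br f_ramp xvec = (\<Sum>j=1..k. ((-1)^j * (of_nat j - 1)) *\<^sub>f br (fvec (k + j)) xvec)"
    unfolding f_ramp_def R_bracket_sum R_bracket_scale ..
  also have "\<dots> = (\<Sum>j=1..k. ((-1)^j * (of_nat j - 1)) *\<^sub>f (g j + g (j + 1)))"
  proof (intro sum.cong refl)
    fix j assume j: "j \<in> {1..k}"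
    show "((-1)^j * (of_nat j - 1)) *\<^sub>f br (fvec (k + j)) xvec = ((-1)^j * (of_nat j - 1)) *\<^sub>f (g j + g (j + 1))"
    proof (cases "j = 1")
      case False
      then have "br (fvec (k + j)) xvec = g j + g (j + 1)"
        using j k by (auto simp: g_def br_unit in_basis_index mult_2 intro!: arg_cong[where f = unit_fun])
      then show ?thesis by simp
    qed (simp add: fscale_def)
  qed
  also have "\<dots> = g 1 - (\<Sum>j=1..k. (-1)^(j - 1) *\<^sub>f g j)"
    unfolding weighted_alternating_telescope by (simp add: g_def)
  also have "\<dots> = fvec (k + 1) - f_tail"
    using k by (simp add: g_def f_tail_def)
  finally show ?thesis .
qed

lemma f_tail_x: "br f_tail xvec = 0"
proof -
  define g :: "nat \<Rightarrow> basis \<Rightarrow> complex" where "g j = (if 2 \<le> j \<and> j \<le> k then fvec (k + j) else 0)" for j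
  have "br f_tail xvec = (\<Sum>j=1..k. (-1)^(j - 1) *\<^sub>f (g j + g (j + 1)))"
    unfolding f_tail_def R_bracket_sum R_bracket_scale using k
    by (intro sum.cong refl arg_cong2[where f = fscale])
      (auto simp: br_unit in_basis_index g_def mult_2 intro!: arg_cong[where f = unit_fun])
  also have "\<dots> = 0" unfolding alternating_telescope by (simp add: g_def)
  finally show ?thesis .
qed

lemma e_f_alt: "br (evec i) f_alt = br (evec i) (evec 1) + (if i = 1 then f_tail else 0)"
  if "1 \<le> i" "i \<le> n - 2 * k"
proof -
  have "br (evec i) f_alt = (\<Sum>j=1..k. (-1)^(j - 1) *\<^sub>f
      ((if j = 1 then br (evec i) (evec 1) else 0) + (if i = 1 then fvec (k + j) else 0)))"
    unfolding f_alt_def R_bracket_sum R_bracket_scale using that k n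
    by (intro sum.cong refl arg_cong2[where f = fscale]) (auto simp: br_unit in_basis_index numeral_2_eq_2)
  also have "\<dots> = (\<Sum>j=1..k. (if j = 1 then br (evec i) (evec 1) else 0)) +
      (\<Sum>j=1..k. (-1)^(j - 1) *\<^sub>f (if i = 1 then fvec (k + j) else 0))"
    unfolding sum.distrib[symmetric]
    by (intro sum.cong refl) (auto simp: fs.scale_right_distrib)
  also have "\<dots> = br (evec i) (evec 1) + (if i = 1 then f_tail else 0)"
    using k by (simp add: f_tail_def)
  finally show ?thesis .
qed

text \<open>The images of the basis vectors under the isomorphism that fixes \<open>f\<^sub>1, \<dots>, f\<^sub>k\<close>, multiplies \<open>E\<close>,
  \<open>e\<^sub>2 + f\<^sub>k\<^sub>+\<^sub>1\<close>, the \<open>e\<^sub>i\<close> with \<open>i \<ge> 3\<close> and the \<open>f\<^sub>j\<close> with \<open>j \<ge> k + 2\<close> by \<open>c\<close>, and multiplies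
  \<open>h\<close> by \<open>c\<^sup>2\<close>.  The terms with \<open>f_alt\<close> and \<open>f_tail\<close> arise from solving this for \<open>e\<^sub>1\<close>, \<open>e\<^sub>2\<close> and
  \<open>f\<^sub>k\<^sub>+\<^sub>1\<close>.  The terms with \<open>f_ramp\<close> arise because the weight zero vectors are
  \<open>E - \<alpha> f_ramp\<close> and \<open>x - \<gamma> f_ramp\<close>, whose counterparts in the target have \<open>c \<alpha>\<close> and \<open>c\<^sup>2 \<gamma>\<close> in
  place of \<open>\<alpha>\<close> and \<open>\<gamma>\<close>.\<close>

definition rescaled :: "complex \<Rightarrow> basis \<Rightarrow> basis \<Rightarrow> complex" where
  "rescaled c a = (case a of
     BE i \<Rightarrow> c *\<^sub>f evec i +
       (if i = 1 then (1 - c) *\<^sub>f f_alt + (\<alpha> * c * (1 - c)) *\<^sub>f f_ramp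
        else if i = 2 then (c * (1 - c)) *\<^sub>f f_tail else 0)
   | BF j \<Rightarrow> if j \<le> k then fvec j
       else c *\<^sub>f fvec j - (if j = k + 1 then (c * (1 - c)) *\<^sub>f f_tail else 0)
   | BX \<Rightarrow> xvec + (\<gamma> * c * (1 - c)) *\<^sub>f f_ramp)"

definition rescale :: "complex \<Rightarrow> (basis \<Rightarrow> complex) \<Rightarrow> basis \<Rightarrow> complex" where
  "rescale c v = (\<Sum>a\<in>basis_index k n. v a *\<^sub>f rescaled c a)"

lemma rescale_add: "rescale c (u + v) = rescale c u + rescale c v"
  by (simp add: rescale_def fs.scale_left_distrib sum.distrib)

lemma rescale_scale: "rescale c (d *\<^sub>f v) = d *\<^sub>f rescale c v"
  unfolding rescale_def fs.scale_sum_right fs.scale_scale by (simp add: fscale_def)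

lemma rescale_zero: "rescale c 0 = 0"
  by (simp add: rescale_def)

lemma rescale_minus: "rescale c (- v) = - rescale c v"
  using rescale_scale[of c "- 1" v] by simp

lemma rescale_diff: "rescale c (u - v) = rescale c u - rescale c v"
  using rescale_add[of c u "- v"] by (simp add: rescale_minus)

lemma rescale_sum: "rescale c (sum w J) = (\<Sum>j\<in>J. rescale c (w j))"
  using sum_comp_morphism[of "rescale c" w J] by (simp add: rescale_zero rescale_add comp_def)

lemma rescale_unit: "rescale c (unit_fun a) = rescaled c a" if "a \<in> basis_index k n"
proof -
  have "rescale c (unit_fun a) = (\<Sum>b\<in>basis_index k n. if b = a then rescaled c b else 0)"
    unfolding rescale_def by (intro sum.cong refl) (auto simp: unit_fun_def)
  then show ?thesis using that by (simp add: finite_basis_index)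
qed

lemma rescale_e: "1 \<le> i \<Longrightarrow> i \<le> n - 2 * k \<Longrightarrow> rescale c (evec i) = rescaled c (BE i)"
  and rescale_f: "1 \<le> j \<Longrightarrow> j \<le> 2 * k \<Longrightarrow> rescale c (fvec j) = rescaled c (BF j)"
  and rescale_x: "rescale c xvec = rescaled c BX"
  by (auto simp: rescale_unit in_basis_index)

lemma rescale_f_alt: "rescale c f_alt = f_alt"
  unfolding f_alt_def rescale_sum rescale_scale
  by (intro sum.cong refl) (auto simp: rescale_f rescaled_def)

lemma rescale_f_ramp: "rescale c f_ramp = c *\<^sub>f f_ramp"
  unfolding f_ramp_def rescale_sum rescale_scale fs.scale_sum_right
  by (intro sum.cong refl) (auto simp: rescale_f rescaled_def fscale_def fun_eq_iff)

text \<open>\<open>f_tail\<close> would be multiplied by \<open>c\<close>, were it not for the correction in the image of its leading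
  term \<open>f\<^sub>k\<^sub>+\<^sub>1\<close>.\<close>

lemma rescale_f_tail: "rescale c f_tail = c\<^sup>2 *\<^sub>f f_tail"
proof -
  have "rescale c f_tail = (\<Sum>j=1..k. (-1)^(j - 1) *\<^sub>f (c *\<^sub>f fvec (k + j)
      - (if j = 1 then (c * (1 - c)) *\<^sub>f f_tail else 0)))"
    unfolding f_tail_def[unfolded One_nat_def] rescale_sum rescale_scale One_nat_def
    by (intro sum.cong refl) (auto simp: rescale_f rescaled_def f_tail_def)
  also have "\<dots> = (\<Sum>j=1..k. c *\<^sub>f ((-1)^(j - 1) *\<^sub>f fvec (k + j)))
      - (\<Sum>j=1..k. if j = 1 then (c * (1 - c)) *\<^sub>f f_tail else 0)"
    unfolding sum_subtractf[symmetric]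
    by (intro sum.cong refl) (auto simp: fscale_def fun_eq_iff algebra_simps)
  also have "\<dots> = c *\<^sub>f f_tail - (c * (1 - c)) *\<^sub>f f_tail"
    using k by (simp add: f_tail_def fs.scale_sum_right)
  also have "\<dots> = c\<^sup>2 *\<^sub>f f_tail"
    by (simp add: fscale_def fun_eq_iff algebra_simps power2_eq_square)
  finally show ?thesis .
qed

end


lemma tail_sum: "(\<Sum>j=Suc 0..k. (-1)^(j - Suc 0) *\<^sub>f fvec (k + j)) = f_tail"
  by (simp add: f_tail_def)

lemmas rescale_simps = rescaled_def R_bracket_add R_bracket_diff R_bracket_scale R_bracket_minus
  R_bracket_zero right_zero left_zero br_unit e_f_alt f_alt_x x_f_alt f_ramp_x f_tail_x
  in_basis_index rescale_e rescale_f rescale_x rescale_f_alt rescale_f_ramp rescale_f_tail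
  rescale_add rescale_diff rescale_scale rescale_minus rescale_zero tail_sum

lemmas coordinatewise = fun_eq_iff fscale_def algebra_simps power2_eq_square numeral_2_eq_2

lemma unit_fun_BX [simp]: "unit_fun (BE i) BX = 0" "unit_fun (BF i) BX = 0"
  by (simp_all add: unit_fun_def)

lemma rescale_table:
  assumes "a \<in> basis_index k n" "b \<in> basis_index k n"
  shows "rescale \<alpha> \<gamma> c (R_table k n \<alpha> \<beta> \<gamma> a b) =
    R_bracket k n (c * \<alpha>, c * \<beta>, c\<^sup>2 * \<gamma>) (rescaled \<alpha> \<gamma> c a) (rescaled \<alpha> \<gamma> c b)"
  using assms k n
  by (cases a; cases b; auto simp: rescale_simps; auto simp: coordinatewise)

text \<open>Rescaling by \<open>1 / c\<close> the algebra that has the already rescaled parameters undoes every step.\<close>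

lemma rescaled_inverse:
  assumes "c \<noteq> 0" "a \<in> basis_index k n"
  shows "rescale (c * \<alpha>) (c\<^sup>2 * \<gamma>) (1 / c) (rescaled \<alpha> \<gamma> c a) = unit_fun a"
  using assms k n
  by (cases a) (auto simp: rescale_simps; auto simp: coordinatewise field_simps)+

lemma rescaled_in_carrier: "rescaled \<alpha> \<gamma> c a \<in> alg_carrier (R_mu2_1 k n p)"
  if "a \<in> basis_index k n"
proof -
  have "f_alt b = 0" "f_tail b = 0" "f_ramp b = 0" if "b \<notin> basis_index k n" for b
    by (rule ccontr, use that f_support[of b] in \<open>force simp: in_basis_index\<close>)+
  moreover have "unit_fun a b = 0" if "b \<notin> basis_index k n" for b
    using that \<open>a \<in> basis_index k n\<close> by (auto simp: unit_fun_def)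
  ultimately show ?thesis
    unfolding alg_carrier_R rescaled_def by (auto simp: fscale_def split: basis.split)
qed

lemma rescale_in_carrier: "rescale \<alpha> \<gamma> c v \<in> alg_carrier (R_mu2_1 k n p)"
  using rescaled_in_carrier[of _ \<alpha> \<gamma> c p]
  by (auto simp: rescale_def alg_carrier_R sum_fun_apply fscale_def intro!: sum.neutral)

lemma rescale_bracket:
  "rescale \<alpha> \<gamma> c (R_bracket k n (\<alpha>, \<beta>, \<gamma>) u v) =
     R_bracket k n (c * \<alpha>, c * \<beta>, c\<^sup>2 * \<gamma>) (rescale \<alpha> \<gamma> c u) (rescale \<alpha> \<gamma> c v)"
proof -
  let ?B = "basis_index k n"
  have "rescale \<alpha> \<gamma> c (R_bracket k n (\<alpha>, \<beta>, \<gamma>) u v) =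
      (\<Sum>a\<in>?B. \<Sum>b\<in>?B. (u a * v b) *\<^sub>f
        R_bracket k n (c * \<alpha>, c * \<beta>, c\<^sup>2 * \<gamma>) (rescaled \<alpha> \<gamma> c a) (rescaled \<alpha> \<gamma> c b))"
    unfolding R_bracket_eq[of k n \<alpha>] rescale_sum rescale_scale
    by (intro sum.cong refl arg_cong2[where f = fscale] rescale_table)
  also have "\<dots> = R_bracket k n (c * \<alpha>, c * \<beta>, c\<^sup>2 * \<gamma>) (rescale \<alpha> \<gamma> c u) (rescale \<alpha> \<gamma> c v)"
    unfolding rescale_def R_bracket_sum R_bracket_scale fs.scale_sum_right fs.scale_scale
    by (subst sum.swap) (simp only: mult.commute)
  finally show ?thesis .
qed

lemma rescale_inverse:
  assumes "c \<noteq> 0" "v \<in> alg_carrier (R_mu2_1 k n p)"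
  shows "rescale (c * \<alpha>) (c\<^sup>2 * \<gamma>) (1 / c) (rescale \<alpha> \<gamma> c v) = v"
proof -
  have "rescale (c * \<alpha>) (c\<^sup>2 * \<gamma>) (1 / c) (rescale \<alpha> \<gamma> c v) = (\<Sum>a\<in>basis_index k n. v a *\<^sub>f unit_fun a)"
    unfolding rescale_def[of \<alpha> \<gamma> c v] rescale_sum rescale_scale
    using assms(1) by (intro sum.cong refl arg_cong2[where f = fscale] rescaled_inverse)
  also have "\<dots> = v"
    using assms(2) by (intro fun_expand[symmetric]) (auto simp: finite_basis_index alg_carrier_R)
  finally show ?thesis .
qed

lemma isomorphic_rescale:
  assumes c: "c \<noteq> 0"
  shows "R_mu2_1 k n (\<alpha>, \<beta>, \<gamma>) \<cong>\<^sub>L R_mu2_1 k n (c * \<alpha>, c * \<beta>, c\<^sup>2 * \<gamma>)"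
proof -
  let ?p = "(\<alpha>, \<beta>, \<gamma>)" and ?q = "(c * \<alpha>, c * \<beta>, c\<^sup>2 * \<gamma>)"
  have right_inv: "rescale \<alpha> \<gamma> c (rescale (c * \<alpha>) (c\<^sup>2 * \<gamma>) (1 / c) v) = v"
    if "v \<in> alg_carrier (R_mu2_1 k n ?q)" for v
    using rescale_inverse[of "1 / c" v ?q "c * \<alpha>" "c\<^sup>2 * \<gamma>"] that c by (simp add: power_divide)
  have "bij_betw (rescale \<alpha> \<gamma> c) (alg_carrier (R_mu2_1 k n ?p)) (alg_carrier (R_mu2_1 k n ?q))"
    by (rule bij_betw_byWitness[where f' = "rescale (c * \<alpha>) (c\<^sup>2 * \<gamma>) (1 / c)"])
      (use c in \<open>auto simp: rescale_inverse[of c _ "(\<alpha>, \<beta>, \<gamma>)"] right_inv rescale_in_carrier\<close>)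
  then have "algebra_iso (R_mu2_1 k n ?p) (R_mu2_1 k n ?q) (rescale \<alpha> \<gamma> c)"
    unfolding algebra_iso_def alg_scale_R by (simp only: rescale_add rescale_scale rescale_bracket) simp
  then show ?thesis unfolding isomorphic_def by blast
qed

section \<open>Coordinates of a product\<close>

text \<open>For an isomorphism, few coordinates of a product carry all the information.  Of the following
  ones, those of \<open>e\<^sub>1\<close> and \<open>x\<close> vanish on all products, and those of \<open>f\<^sub>1\<close>, \<open>e\<^sub>2\<close> and \<open>e\<^sub>3\<close> depend neither
  on the parameters nor on further coordinates of the factors.\<close>

lemma coeff_e1: "R_bracket k n p u v (BE 1) = 0"
proof -
  obtain \<alpha> \<beta> \<gamma> where p: "p = (\<alpha>, \<beta>, \<gamma>)" by (cases p)
  have "R_table k n \<alpha> \<beta> \<gamma> a b (BE 1) = 0" if "a \<in> basis_index k n" "b \<in> basis_index k n" for a b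
    using that k n by (cases a; cases b) (auto simp: unit_fun_def fscale_def sum_fun_apply in_basis_index)
  then show ?thesis by (simp add: p R_bracket_coeff)
qed

lemma coeff_x: "R_bracket k n p u v BX = 0"
proof -
  obtain \<alpha> \<beta> \<gamma> where p: "p = (\<alpha>, \<beta>, \<gamma>)" by (cases p)
  have "R_table k n \<alpha> \<beta> \<gamma> a b BX = 0" for a b
    by (cases a; cases b) (auto simp: unit_fun_def fscale_def sum_fun_apply)
  then show ?thesis by (simp add: p R_bracket_coeff)
qed

lemma coeff_f1:
  "R_bracket k n p u v (BF 1) = (u (BF 1) + u (BE 1)) * v BX - u BX * (v (BE 1) + v (BF 1))"
proof -
  obtain \<alpha> \<beta> \<gamma> where p: "p = (\<alpha>, \<beta>, \<gamma>)" by (cases p)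
  have "R_table k n \<alpha> \<beta> \<gamma> a b (BF 1) =
      (if a = BF 1 \<and> b = BX then 1 else 0) + (if a = BE 1 \<and> b = BX then 1 else 0)
      + (if a = BX \<and> b = BE 1 then -1 else 0) + (if a = BX \<and> b = BF 1 then -1 else 0)"
    if "a \<in> basis_index k n" "b \<in> basis_index k n" for a b
    using that k n by (cases a; cases b) (auto simp: unit_fun_def fscale_def sum_fun_apply in_basis_index)
  moreover have "BF 1 \<in> basis_index k n" "BE 1 \<in> basis_index k n"
    using k n by (auto simp: in_basis_index)
  ultimately show ?thesis
    by (simp add: p R_bracket_coeff distrib_left sum.distrib sum_at_pair finite_basis_index in_basis_index
        del: One_nat_def) (simp add: algebra_simps)
qed

lemma coeff_e2:
  "R_bracket k n p u v (BE 2) = u (BE 1) * (v (BE 1) + v (BF 1)) + u (BE 2) * v BX"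
proof -
  obtain \<alpha> \<beta> \<gamma> where p: "p = (\<alpha>, \<beta>, \<gamma>)" by (cases p)
  have "R_table k n \<alpha> \<beta> \<gamma> a b (BE 2) =
      (if a = BE 1 \<and> b = BE 1 then 1 else 0) + (if a = BE 1 \<and> b = BF 1 then 1 else 0)
      + (if a = BE 2 \<and> b = BX then 1 else 0)"
    if "a \<in> basis_index k n" "b \<in> basis_index k n" for a b
    using that k n by (cases a; cases b) (auto simp: unit_fun_def fscale_def sum_fun_apply in_basis_index)
  moreover have "BF 1 \<in> basis_index k n" "BE 1 \<in> basis_index k n" "BE 2 \<in> basis_index k n"
    using k n by (auto simp: in_basis_index)
  ultimately show ?thesis
    by (simp add: p R_bracket_coeff distrib_left sum.distrib sum_at_pair finite_basis_index in_basis_index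
        del: One_nat_def)
qed

lemma coeff_e3:
  "R_bracket k n p u v (BE 3) = u (BE 2) * (v (BE 1) + v (BF 1)) + 2 * u (BE 3) * v BX"
proof -
  obtain \<alpha> \<beta> \<gamma> where p: "p = (\<alpha>, \<beta>, \<gamma>)" by (cases p)
  have "R_table k n \<alpha> \<beta> \<gamma> a b (BE 3) =
      (if a = BE 2 \<and> b = BE 1 then 1 else 0) + (if a = BE 2 \<and> b = BF 1 then 1 else 0)
      + (if a = BE 3 \<and> b = BX then 2 else 0)"
    if "a \<in> basis_index k n" "b \<in> basis_index k n" for a b
    using that k n by (cases a; cases b) (auto simp: unit_fun_def fscale_def sum_fun_apply in_basis_index)
  moreover have "BF 1 \<in> basis_index k n" "BE 1 \<in> basis_index k n" "BE 2 \<in> basis_index k n"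
      "BE 3 \<in> basis_index k n"
    using k n by (auto simp: in_basis_index)
  ultimately show ?thesis
    by (simp add: p R_bracket_coeff distrib_left sum.distrib sum_at_pair finite_basis_index in_basis_index
        del: One_nat_def)
qed

text \<open>The coefficient of \<open>h\<close> in the weight decomposition: modulo positive weights \<open>f\<^sub>k\<^sub>+\<^sub>1\<close> is \<open>h\<close>, and
  \<open>e\<^sub>2\<close> is \<open>-h\<close> since \<open>e\<^sub>2 + f\<^sub>k\<^sub>+\<^sub>1\<close> has weight one.\<close>

definition eta :: "(basis \<Rightarrow> complex) \<Rightarrow> complex" where
  "eta v = v (BF (k + 1)) - v (BE 2)"

text \<open>The parameters as the entries of a bilinear form with matrix
  \<open>(-1, \<alpha>; \<beta>, \<gamma>)\<close> on the plane of \<open>e\<^sub>1\<close> and \<open>x\<close>.\<close>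

lemma eta_bracket:
  "eta (R_bracket k n (\<alpha>, \<beta>, \<gamma>) u v) =
     - (u (BE 1) * v (BE 1)) + \<alpha> * u (BE 1) * v BX + \<beta> * u BX * v (BE 1) + \<gamma> * u BX * v BX"
proof -
  have tail: "(\<Sum>j=Suc 0..k. (-1)^(j - Suc 0) * unit_fun (BF (k + j)) (BF (Suc k))) = (1::complex)"
  proof -
    have "(\<Sum>j=Suc 0..k. (-1)^(j - Suc 0) * unit_fun (BF (k + j)) (BF (Suc k))) =
          (\<Sum>j=Suc 0..k. if j = 1 then 1 else (0::complex))"
      by (intro sum.cong refl) (auto simp: unit_fun_def)
    then show ?thesis using k by simp
  qed
  have "R_table k n \<alpha> \<beta> \<gamma> a b (BF (k + 1)) - R_table k n \<alpha> \<beta> \<gamma> a b (BE 2) =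
      (if a = BE 1 \<and> b = BE 1 then -1 else 0) + (if a = BE 1 \<and> b = BX then \<alpha> else 0)
      + (if a = BX \<and> b = BE 1 then \<beta> else 0) + (if a = BX \<and> b = BX then \<gamma> else 0)"
    if "a \<in> basis_index k n" "b \<in> basis_index k n" for a b
    using that k n
    by (cases a; cases b)
       (auto simp: fscale_def sum_fun_apply in_basis_index tail, auto simp: unit_fun_def)
  note T = this
  have "eta (R_bracket k n (\<alpha>, \<beta>, \<gamma>) u v) =
     (\<Sum>a\<in>basis_index k n. \<Sum>b\<in>basis_index k n. u a * v b *
       (R_table k n \<alpha> \<beta> \<gamma> a b (BF (k + 1)) - R_table k n \<alpha> \<beta> \<gamma> a b (BE 2)))"
    by (simp add: eta_def R_bracket_coeff sum_subtractf right_diff_distrib)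
  moreover have "BE 1 \<in> basis_index k n"
    using n by (auto simp: in_basis_index)
  ultimately show ?thesis
    by (simp add: T distrib_left sum.distrib sum_at_pair finite_basis_index in_basis_index
        del: One_nat_def)
qed


section \<open>Isomorphic algebras have proportional parameters\<close>

lemma iso_sum:
  assumes iso: "algebra_iso (R_mu2_1 k n p) (R_mu2_1 k n q) \<phi>"
    and w: "\<And>j. j \<in> J \<Longrightarrow> w j \<in> alg_carrier (R_mu2_1 k n p)"
  shows "\<phi> (sum w J) = (\<Sum>j\<in>J. \<phi> (w j))"
proof -
  let ?C = "alg_carrier (R_mu2_1 k n p)"
  have C0: "0 \<in> ?C" by (simp add: alg_carrier_R)
  have "\<phi> (0 + 0) = \<phi> 0 + \<phi> 0"
    using iso C0 unfolding algebra_iso_def by blast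
  then have zero: "\<phi> 0 = 0" by simp
  have "sum w J \<in> ?C \<and> \<phi> (sum w J) = (\<Sum>j\<in>J. \<phi> (w j))"
    using w
  proof (induction J rule: infinite_finite_induct)
    case (insert j J)
    then have "w j \<in> ?C" "sum w J \<in> ?C" by auto
    moreover from this have "\<phi> (w j + sum w J) = \<phi> (w j) + \<phi> (sum w J)"
      using iso unfolding algebra_iso_def by blast
    moreover have "sum w (insert j J) = w j + sum w J"
      using insert(1,2) by (rule sum.insert)
    ultimately show ?case using insert by (simp only: sum.insert carrier_add_scale) simp
  qed (auto simp: zero C0)
  then show ?thesis ..
qed

lemma iso_expand:
  assumes iso: "algebra_iso (R_mu2_1 k n p) (R_mu2_1 k n q) \<phi>"
    and v: "v \<in> alg_carrier (R_mu2_1 k n p)"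
  shows "\<phi> v = (\<Sum>a\<in>basis_index k n. v a *\<^sub>f \<phi> (unit_fun a))"
proof -
  have "v = (\<Sum>a\<in>basis_index k n. v a *\<^sub>f unit_fun a)"
    using v by (intro fun_expand) (auto simp: finite_basis_index alg_carrier_R)
  then have "\<phi> v = \<phi> (\<Sum>a\<in>basis_index k n. v a *\<^sub>f unit_fun a)" by simp
  also have "\<dots> = (\<Sum>a\<in>basis_index k n. \<phi> (v a *\<^sub>f unit_fun a))"
    by (intro iso_sum[OF iso] carrier_add_scale unit_in_carrier)
  also have "\<dots> = (\<Sum>a\<in>basis_index k n. v a *\<^sub>f \<phi> (unit_fun a))"
    using iso unit_in_carrier[of _ p] unfolding algebra_iso_def
    by (intro sum.cong refl) auto
  finally show ?thesis .
qed

text \<open>For such a coordinate \<open>c\<close>, the functional \<open>v \<mapsto> \<phi> v c\<close> factors through the plane of \<open>e\<^sub>1\<close> and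
  \<open>x\<close>.  Three coordinates of the target can therefore not all be of this kind, because an
  isomorphism pulls them back to independent functionals.\<close>

lemma iso_coord_expand:
  assumes iso: "algebra_iso (R_mu2_1 k n p) (R_mu2_1 k n q) \<phi>"
    and v: "v \<in> alg_carrier (R_mu2_1 k n p)"
    and van: "\<And>a. a \<in> basis_index k n \<Longrightarrow> a \<noteq> BE 1 \<Longrightarrow> a \<noteq> BX \<Longrightarrow> \<phi> (unit_fun a) c = 0"
  shows "\<phi> v c = v (BE 1) * \<phi> (evec 1) c + v BX * \<phi> xvec c"
proof -
  have "\<phi> v c = (\<Sum>a\<in>basis_index k n. v a * \<phi> (unit_fun a) c)"
    by (simp add: iso_expand[OF iso v] sum_fun_apply fscale_def)
  also have "\<dots> = (\<Sum>a\<in>{BE 1, BX}. v a * \<phi> (unit_fun a) c)"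
    using n van by (intro sum.mono_neutral_right) (auto simp: finite_basis_index in_basis_index)
  finally show ?thesis by simp
qed

text \<open>The form in which the Jordan block \<open>[f\<^sub>i, x] = f\<^sub>i + f\<^sub>i\<^sub>+\<^sub>1\<close>, \<open>[f\<^sub>k, x] = f\<^sub>k\<close> is used: a functional that is zero
  on these products is zero on the \<open>f\<^sub>i\<close>.\<close>

lemma descending_vanish:
  fixes g :: "nat \<Rightarrow> complex"
  assumes "g m = 0" "\<And>i. 1 \<le> i \<Longrightarrow> i < m \<Longrightarrow> g i + g (Suc i) = 0" "1 \<le> i" "i \<le> m"
  shows "g i = 0"
  using assms(4,3)
proof (induction i rule: inc_induct)
  case (step i)
  then show ?case using assms(2)[of i] by simp
qed (rule assms(1))


context
  fixes \<alpha> \<beta> \<gamma> :: complex and q :: "complex \<times> complex \<times> complex"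
    and \<phi> :: "(basis \<Rightarrow> complex) \<Rightarrow> basis \<Rightarrow> complex"
  assumes iso: "algebra_iso (R_mu2_1 k n (\<alpha>, \<beta>, \<gamma>)) (R_mu2_1 k n q) \<phi>"
begin

lemma img_add: "\<phi> (u + v) = \<phi> u + \<phi> v"
  if "u \<in> alg_carrier (R_mu2_1 k n (\<alpha>, \<beta>, \<gamma>))" "v \<in> alg_carrier (R_mu2_1 k n (\<alpha>, \<beta>, \<gamma>))"
  using iso that unfolding algebra_iso_def by blast

lemma img_add_unit: "\<phi> (unit_fun a + unit_fun b) = \<phi> (unit_fun a) + \<phi> (unit_fun b)"
  if "a \<in> basis_index k n" "b \<in> basis_index k n"
  by (intro img_add unit_in_carrier that)

lemma img_scale: "\<phi> (c *\<^sub>f u) = c *\<^sub>f \<phi> u" if "u \<in> alg_carrier (R_mu2_1 k n (\<alpha>, \<beta>, \<gamma>))"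
  using iso that unfolding algebra_iso_def alg_scale_R by blast

lemma img_zero: "\<phi> 0 = 0"
  using iso_sum[OF iso, of "{}" "\<lambda>_. 0"] by simp

lemma img_table:
  "R_bracket k n q (\<phi> (unit_fun a)) (\<phi> (unit_fun b)) = \<phi> (R_table k n \<alpha> \<beta> \<gamma> a b)"
  if "a \<in> basis_index k n" "b \<in> basis_index k n"
proof -
  have "\<phi> (R_bracket k n (\<alpha>, \<beta>, \<gamma>) (unit_fun a) (unit_fun b)) =
        R_bracket k n q (\<phi> (unit_fun a)) (\<phi> (unit_fun b))"
    using iso that[THEN unit_in_carrier, of "(\<alpha>, \<beta>, \<gamma>)"] unfolding algebra_iso_def by blast
  then show ?thesis by (simp only: R_mu2_1_bracket[OF k n that])
qed

lemma img_e1_e1: "R_bracket k n q (\<phi> (evec 1)) (\<phi> (evec 1)) = \<phi> (evec 2)"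
  using n by (subst img_table) (auto simp: in_basis_index numeral_2_eq_2)

lemma img_e_f1: "R_bracket k n q (\<phi> (evec i)) (\<phi> (fvec 1)) = \<phi> (evec (Suc i))"
  if "2 \<le> i" "i < n - 2*k"
  using k n that by (subst img_table) (auto simp: in_basis_index)

lemma img_e1_f1: "R_bracket k n q (\<phi> (evec 1)) (\<phi> (fvec 1)) = \<phi> (evec 2) + \<phi> (fvec (k + 1))"
  using k n by (subst img_table) (auto simp: in_basis_index img_add_unit)

lemma img_e1_f: "R_bracket k n q (\<phi> (evec 1)) (\<phi> (fvec j)) = \<phi> (fvec (k + j))"
  if "2 \<le> j" "j \<le> k"
  using k n that by (subst img_table) (auto simp: in_basis_index)

lemma img_f_x: "R_bracket k n q (\<phi> (fvec j)) (\<phi> xvec) = \<phi> (fvec j) + \<phi> (fvec (Suc j))"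
  if "1 \<le> j" "j < k"
  using k n that by (subst img_table) (auto simp: in_basis_index img_add_unit)

lemma img_fk_x: "R_bracket k n q (\<phi> (fvec k)) (\<phi> xvec) = \<phi> (fvec k)"
  using k n by (subst img_table) (auto simp: in_basis_index)

lemma img_f_e1: "R_bracket k n q (\<phi> (fvec j)) (\<phi> (evec 1)) = 0" if "1 \<le> j" "j \<le> k"
  using k n that by (subst img_table) (auto simp: in_basis_index img_zero)

lemma img_f_f: "R_bracket k n q (\<phi> (fvec j)) (\<phi> (fvec j)) = 0" if "1 \<le> j" "j \<le> k"
  using k n that by (subst img_table) (auto simp: in_basis_index img_zero)

lemma fvec_carrier: "fvec i \<in> alg_carrier (R_mu2_1 k n p)" if "1 \<le> i" "i \<le> 2 * k"
  using that by (intro unit_in_carrier) (simp add: in_basis_index)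

lemma img_e1_x:
  "R_bracket k n q (\<phi> (evec 1)) (\<phi> xvec) = \<phi> (fvec 1) + \<alpha> *\<^sub>f \<phi> (fvec (k + 1))"
proof -
  have "R_bracket k n q (\<phi> (evec 1)) (\<phi> xvec) = \<phi> (fvec 1 + \<alpha> *\<^sub>f fvec (k + 1))"
    using n by (subst img_table) (auto simp: in_basis_index)
  also have "\<dots> = \<phi> (fvec 1) + \<phi> (\<alpha> *\<^sub>f fvec (k + 1))"
    using k by (intro img_add carrier_add_scale(2) fvec_carrier) auto
  finally show ?thesis using k by (simp add: img_scale fvec_carrier)
qed

lemma img_x_f:
  "R_bracket k n q (\<phi> xvec) (\<phi> (fvec j)) = - R_bracket k n q (\<phi> (fvec j)) (\<phi> xvec)"
  if "1 \<le> j" "j \<le> k"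
proof -
  have "R_table k n \<alpha> \<beta> \<gamma> BX (BF j) = (- 1) *\<^sub>f R_table k n \<alpha> \<beta> \<gamma> (BF j) BX"
    using that by simp
  moreover have "R_table k n \<alpha> \<beta> \<gamma> (BF j) BX \<in> alg_carrier (R_mu2_1 k n (\<alpha>, \<beta>, \<gamma>))"
    using that k by (auto simp: fvec_carrier carrier_add_scale)
  ultimately have "\<phi> (R_table k n \<alpha> \<beta> \<gamma> BX (BF j)) = (- 1) *\<^sub>f \<phi> (R_table k n \<alpha> \<beta> \<gamma> (BF j) BX)"
    by (simp only: img_scale)
  then show ?thesis using that k
    by (simp add: img_table in_basis_index del: R_table.simps)
qed

lemma img_x_e1:
  "R_bracket k n q (\<phi> xvec) (\<phi> (evec 1)) =
     - \<phi> (fvec 1) + \<beta> *\<^sub>f (\<Sum>j=1..k. (-1)^(j - 1) *\<^sub>f \<phi> (fvec (k + j)))"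
proof -
  let ?C = "alg_carrier (R_mu2_1 k n (\<alpha>, \<beta>, \<gamma>))"
  define h where "h = (\<Sum>j=1..k. (-1)^(j - 1) *\<^sub>f fvec (k + j))"
  have w: "(-1)^(j - 1) *\<^sub>f fvec (k + j) \<in> ?C" if "j \<in> {1..k}" for j
    using that by (intro carrier_add_scale fvec_carrier) auto
  have "h \<in> ?C" using w by (auto simp: h_def sum_fun_apply alg_carrier_R)
  moreover have "\<phi> h = (\<Sum>j=1..k. (-1)^(j - 1) *\<^sub>f \<phi> (fvec (k + j)))"
    unfolding h_def by (subst iso_sum[OF iso w]) (auto intro!: sum.cong img_scale fvec_carrier)
  moreover have "R_bracket k n q (\<phi> xvec) (\<phi> (evec 1)) = \<phi> ((- 1) *\<^sub>f fvec 1 + \<beta> *\<^sub>f h)"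
    using n by (subst img_table) (auto simp: in_basis_index h_def)
  moreover have "\<phi> ((- 1) *\<^sub>f fvec 1 + \<beta> *\<^sub>f h) = \<phi> ((- 1) *\<^sub>f fvec 1) + \<phi> (\<beta> *\<^sub>f h)"
    using k by (intro img_add carrier_add_scale(2) fvec_carrier \<open>h \<in> ?C\<close>) auto
  ultimately show ?thesis
    using img_scale[OF fvec_carrier[of 1], of "- 1"] k by (simp add: img_scale)
qed

lemma img_x_x: "R_bracket k n q (\<phi> xvec) (\<phi> xvec) = \<gamma> *\<^sub>f \<phi> (fvec (k + 1))"
  using k by (subst img_table) (simp_all add: in_basis_index img_scale fvec_carrier)


text \<open>All basis vectors other than \<open>e\<^sub>1\<close>, \<open>x\<close> and \<open>f\<^sub>1, \<dots>, f\<^sub>k\<close> are obtained from products with left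
  factor some \<open>e\<^sub>i\<close>, so it suffices to look at the coordinate of these products.\<close>

lemma img_vanish:
  assumes f: "\<And>i. 1 \<le> i \<Longrightarrow> i \<le> k \<Longrightarrow> \<phi> (fvec i) c = 0"
    and e1e1: "R_bracket k n q (\<phi> (evec 1)) (\<phi> (evec 1)) c = 0"
    and e1f: "\<And>j. 1 \<le> j \<Longrightarrow> j \<le> k \<Longrightarrow> R_bracket k n q (\<phi> (evec 1)) (\<phi> (fvec j)) c = 0"
    and ef1: "\<And>i. 2 \<le> i \<Longrightarrow> i < n - 2*k \<Longrightarrow> R_bracket k n q (\<phi> (evec i)) (\<phi> (fvec 1)) c = 0"
    and d: "d \<in> basis_index k n" "d \<noteq> BE 1" "d \<noteq> BX"
  shows "\<phi> (unit_fun d) c = 0"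
proof -
  have e2: "\<phi> (evec 2) c = 0" using e1e1 by (simp only: img_e1_e1)
  show ?thesis
  proof (cases d)
    case (BE i)
    then have i: "2 \<le> i" "i \<le> n - 2*k" using d by (auto simp: in_basis_index)
    show ?thesis
    proof (cases "i = 2")
      case False
      then have "2 \<le> i - 1" "i - 1 < n - 2*k" "Suc (i - 1) = i" using i by auto
      then show ?thesis using ef1[of "i - 1"] by (simp only: img_e_f1 BE)
    qed (simp add: BE e2)
  next
    case (BF i)
    then have i: "1 \<le> i" "i \<le> 2*k" using d by (auto simp: in_basis_index)
    consider "i \<le> k" | "i = k + 1" | "k + 2 \<le> i" by linarith
    then show ?thesis
    proof cases
      case 1
      then show ?thesis using i f by (simp add: BF)
    next
      case 2
      have "(\<phi> (evec 2) + \<phi> (fvec (k + 1))) c = 0"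
        using e1f[of 1] k by (simp only: img_e1_f1)
      then show ?thesis using e2 by (simp add: BF 2)
    next
      case 3
      then have "2 \<le> i - k" "i - k \<le> k" "1 \<le> i - k" "k + (i - k) = i" using i by auto
      then show ?thesis using e1f[of "i - k"] by (simp only: img_e1_f BF)
    qed
  qed (use d in simp)
qed

lemma img_f_coord: "\<phi> (fvec i) c = 0"
  if i: "1 \<le> i" "i \<le> k" and c: "\<And>u v. R_bracket k n q u v c = 0"
proof (rule descending_vanish[where m = k])
  show "\<phi> (fvec k) c = 0" by (subst img_fk_x[symmetric]) (rule c)
  show "\<phi> (fvec i) c + \<phi> (fvec (Suc i)) c = 0" if "1 \<le> i" "i < k" for i
    using c[of "\<phi> (fvec i)" "\<phi> xvec"] by (simp only: img_f_x[OF that] plus_fun_apply)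
qed (use i in auto)

lemma img_e1_x_coord: "\<phi> (unit_fun d) c = 0"
  if c: "c = BE 1 \<or> c = BX" and d: "d \<in> basis_index k n" "d \<noteq> BE 1" "d \<noteq> BX"
proof -
  have br: "R_bracket k n q u v c = 0" for u v using c coeff_e1 coeff_x by metis
  show ?thesis by (rule img_vanish[OF _ _ _ _ d]) (simp_all only: br img_f_coord)
qed

lemma img_f_e1_x_coord: "\<phi> (fvec j) (BE 1) = 0" "\<phi> (fvec j) BX = 0" if "1 \<le> j" "j \<le> 2 * k"
  using that by (auto intro!: img_e1_x_coord simp: in_basis_index)

text \<open>Surjectivity gives both claims.  The \<open>e\<^sub>1\<close>- and \<open>x\<close>-coordinates of the image depend on the
  plane of \<open>e\<^sub>1\<close> and \<open>x\<close> only, and they take all values, so the induced map of planes is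
  invertible.  If the \<open>f\<^sub>1\<close>-coordinate vanished on all images of the \<open>f\<^sub>j\<close>, then it would factor
  through the same plane, hence vanish wherever the other two coordinates do; but a preimage of
  \<open>f\<^sub>1\<close> contradicts this.\<close>

lemma img_coord_det:
  "\<phi> (evec 1) (BE 1) * \<phi> xvec BX - \<phi> (evec 1) BX * \<phi> xvec (BE 1) \<noteq> 0"
  and img_f1_coord_nonzero: "\<exists>j. 1 \<le> j \<and> j \<le> k \<and> \<phi> (fvec j) (BF 1) \<noteq> 0"
proof -
  define a b t s where "a = \<phi> (evec 1) (BE 1)" and "b = \<phi> (evec 1) BX"
    and "t = \<phi> xvec (BE 1)" and "s = \<phi> xvec BX"
  note abts = a_def b_def t_def s_def
  let ?C = "alg_carrier (R_mu2_1 k n (\<alpha>, \<beta>, \<gamma>))"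
  have co_e1: "\<phi> v (BE 1) = v (BE 1) * a + v BX * t" and co_x: "\<phi> v BX = v (BE 1) * b + v BX * s"
    if "v \<in> ?C" for v
    unfolding abts by (intro iso_coord_expand[OF iso that img_e1_x_coord]; simp)+
  have surj: "\<exists>v\<in>?C. \<phi> v = unit_fun d" if "d \<in> basis_index k n" for d
  proof -
    have "unit_fun d \<in> \<phi> ` ?C"
      using iso unit_in_carrier[OF that, of q] unfolding algebra_iso_def bij_betw_def by blast
    then show ?thesis by auto
  qed
  obtain v1 where v1: "v1 \<in> ?C" "\<phi> v1 = evec 1"
    using surj[of "BE 1"] n by (auto simp: in_basis_index)
  obtain v2 where v2: "v2 \<in> ?C" "\<phi> v2 = xvec"
    using surj[of BX] by (auto simp: in_basis_index)
  obtain v3 where v3: "v3 \<in> ?C" "\<phi> v3 = fvec 1"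
    using surj[of "BF 1"] k by (auto simp: in_basis_index)
  have inv: "v1 (BE 1) * a + v1 BX * t = 1" "v1 (BE 1) * b + v1 BX * s = 0"
    "v2 (BE 1) * a + v2 BX * t = 0" "v2 (BE 1) * b + v2 BX * s = 1"
    "v3 (BE 1) * a + v3 BX * t = 0" "v3 (BE 1) * b + v3 BX * s = 0"
    using co_e1[OF v1(1)] co_x[OF v1(1)] co_e1[OF v2(1)] co_x[OF v2(1)] co_e1[OF v3(1)] co_x[OF v3(1)]
    unfolding v1(2) v2(2) v3(2) by (simp_all add: unit_fun_def)
  have det: "a * s - b * t \<noteq> 0"
  proof
    assume "a * s - b * t = 0"
    moreover have "(v1 (BE 1) * v2 BX - v1 BX * v2 (BE 1)) * (a * s - b * t) = 1"
      using inv(1-4) by algebra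
    ultimately show False by simp
  qed
  then show "\<phi> (evec 1) (BE 1) * \<phi> xvec BX - \<phi> (evec 1) BX * \<phi> xvec (BE 1) \<noteq> 0"
    unfolding abts .
  have "v3 (BE 1) * (a * s - b * t) = 0" "v3 BX * (a * s - b * t) = 0"
    using inv(5,6) by algebra+
  then have v3_0: "v3 (BE 1) = 0" "v3 BX = 0" using det by auto
  show "\<exists>j. 1 \<le> j \<and> j \<le> k \<and> \<phi> (fvec j) (BF 1) \<noteq> 0"
  proof (rule ccontr)
    assume "\<not> ?thesis"
    then have z: "\<phi> (fvec j) (BF 1) = 0" if "1 \<le> j" "j \<le> k" for j using that by blast
    have e: "\<phi> (evec i) (BE 1) = 0" "\<phi> (evec i) BX = 0" if "2 \<le> i" "i \<le> n - 2*k" for i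
      using that by (auto intro!: img_e1_x_coord simp: in_basis_index)
    have "\<phi> (unit_fun d) (BF 1) = 0" if "d \<in> basis_index k n" "d \<noteq> BE 1" "d \<noteq> BX" for d
    proof (rule img_vanish[OF _ _ _ _ that])
      show "R_bracket k n q (\<phi> (evec 1)) (\<phi> (evec 1)) (BF 1) = 0"
        by (simp only: coeff_f1) (simp add: algebra_simps)
      have f0: "\<phi> (fvec j) (BE 1) = 0" "\<phi> (fvec j) BX = 0" "\<phi> (fvec j) (BF 1) = 0"
        if "1 \<le> j" "j \<le> k" for j
        using that img_f_e1_x_coord[of j] z[OF that] by auto
      show "R_bracket k n q (\<phi> (evec 1)) (\<phi> (fvec j)) (BF 1) = 0" if "1 \<le> j" "j \<le> k" for j
        unfolding coeff_f1 f0[OF that] by simp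
      show "R_bracket k n q (\<phi> (evec i)) (\<phi> (fvec 1)) (BF 1) = 0" if "2 \<le> i" "i < n - 2*k" for i
        unfolding coeff_f1 using f0[of 1] e[of i] that k by simp
    qed (rule z)
    from iso_coord_expand[OF iso v3(1) this] have "\<phi> v3 (BF 1) = 0"
      unfolding v3_0 by simp
    then show False by (simp add: v3(2) unit_fun_def)
  qed
qed

text \<open>Let \<open>g\<close> be the image of the last \<open>f\<^sub>j\<close> with \<open>j \<le> k\<close> whose image has nonzero \<open>f\<^sub>1\<close>-coordinate.
  In the \<open>f\<^sub>1\<close>-coordinate, right multiplication by a vector multiplies \<open>g\<close> by the
  \<open>x\<close>-coordinate of that vector.  By the choice of \<open>j\<close> this factor is \<open>1\<close> for the image of \<open>x\<close>, and
  it is \<open>0\<close> for the image of \<open>e\<^sub>1\<close> since \<open>[f\<^sub>j, e\<^sub>1] = 0\<close>.  If the image of \<open>x\<close> involved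
  \<open>e\<^sub>1\<close>, then \<open>[x, f\<^sub>j] = -[f\<^sub>j, x]\<close> would force an \<open>e\<^sub>2\<close>-component on \<open>g\<close>, and
  \<open>[g, g]\<close> would have an \<open>e\<^sub>3\<close>-component, against \<open>[f\<^sub>j, f\<^sub>j] = 0\<close>.\<close>

lemma img_coords:
  "\<phi> xvec BX = 1" "\<phi> (evec 1) BX = 0" "\<phi> xvec (BE 1) = 0"
proof -
  define a b t s where "a = \<phi> (evec 1) (BE 1)" and "b = \<phi> (evec 1) BX"
    and "t = \<phi> xvec (BE 1)" and "s = \<phi> xvec BX"
  note abts = a_def b_def t_def s_def
  \<comment> \<open>Taking the last such index makes \<open>[f\<^sub>j, x]\<close> agree with \<open>f\<^sub>j\<close> in the \<open>f\<^sub>1\<close>-coordinate.\<close>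
  define P where "P j \<longleftrightarrow> 1 \<le> j \<and> j \<le> k \<and> \<phi> (fvec j) (BF 1) \<noteq> 0" for j
  have P_le: "i \<le> k" if "P i" for i using that by (simp add: P_def)
  define j where "j = Greatest P"
  have j: "P j"
    unfolding j_def
  proof (rule GreatestI_ex_nat[of P k])
    show "\<exists>i. P i" using img_f1_coord_nonzero by (simp only: P_def)
  qed (rule P_le)
  have j_max: "i \<le> j" if "P i" for i
    unfolding j_def by (rule Greatest_le_nat[of P i k, OF that P_le])
  have jk: "1 \<le> j" "j \<le> k" and nz: "\<phi> (fvec j) (BF 1) \<noteq> 0"
    using j by (auto simp: P_def)
  have f0: "\<phi> (fvec j) (BE 1) = 0" "\<phi> (fvec j) BX = 0"
    using jk img_f_e1_x_coord[of j] by auto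
  have fx: "R_bracket k n q (\<phi> (fvec j)) (\<phi> xvec) (BF 1) = \<phi> (fvec j) (BF 1)"
  proof (cases "j = k")
    case True
    then show ?thesis by (simp only: img_fk_x)
  next
    case False
    then have "j < k" "\<phi> (fvec (Suc j)) (BF 1) = 0"
      using jk j_max[of "Suc j"] by (auto simp: P_def)
    then show ?thesis using jk by (simp add: img_f_x)
  qed
  then have "\<phi> (fvec j) (BF 1) * s = \<phi> (fvec j) (BF 1)"
    unfolding coeff_f1 f0 by (simp add: abts)
  then have s: "s = 1" using nz by simp
  have "R_bracket k n q (\<phi> (fvec j)) (\<phi> (evec 1)) (BF 1) = 0"
    using jk by (simp only: img_f_e1) simp
  then have b: "b = 0" unfolding coeff_f1 f0 using nz by (simp add: abts)
  have "R_bracket k n q (\<phi> (fvec j)) (\<phi> (fvec j)) (BE 3) = 0"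
    using jk by (simp only: img_f_f) simp
  then have l: "\<phi> (fvec j) (BE 2) = 0" unfolding coeff_e3 f0 using nz by simp
  have "R_bracket k n q (\<phi> xvec) (\<phi> (fvec j)) (BE 2) = - R_bracket k n q (\<phi> (fvec j)) (\<phi> xvec) (BE 2)"
    using jk by (simp only: img_x_f) simp
  then have t: "t = 0" unfolding coeff_e2 f0 l using nz by (simp add: abts)
  show "\<phi> xvec BX = 1" "\<phi> (evec 1) BX = 0" "\<phi> xvec (BE 1) = 0"
    using s b t by (simp_all only: abts)
qed

end

lemma eta_linear:
  "eta (u + v) = eta u + eta v" "eta (c *\<^sub>f u) = c * eta u" "eta (- u) = - eta u"
  "eta (sum w J) = (\<Sum>j\<in>J. eta (w j))"
  unfolding eta_def fscale_def sum_fun_apply by (simp_all add: sum_subtractf right_diff_distrib)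

text \<open>The scaling factor is the coefficient of \<open>e\<^sub>1\<close> in its image.  Since \<open>\<phi>\<close> maps \<open>f\<^sub>k\<^sub>+\<^sub>1\<close> to an
  element on which \<open>eta\<close> is \<open>a\<^sup>2\<close>, and the \<open>f\<^sub>j\<close> other than \<open>f\<^sub>k\<^sub>+\<^sub>1\<close> that occur in the three products below to
  elements on which \<open>eta\<close> is zero, applying \<open>eta\<close> to the images of \<open>[e\<^sub>1, x]\<close>, \<open>[x, e\<^sub>1]\<close> and
  \<open>[x, x]\<close> compares the parameters.\<close>

lemma iso_params:
  assumes iso: "algebra_iso (R_mu2_1 k n (\<alpha>, \<beta>, \<gamma>)) (R_mu2_1 k n (\<alpha>', \<beta>', \<gamma>')) \<phi>"
  shows "\<exists>c. c \<noteq> 0 \<and> \<alpha>' = c * \<alpha> \<and> \<beta>' = c * \<beta> \<and> \<gamma>' = c\<^sup>2 * \<gamma>"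
proof -
  define a where "a = \<phi> (evec 1) (BE 1)"
  note co = img_coords[OF iso] a_def[symmetric]
  have a: "a \<noteq> 0" using img_coord_det[OF iso] unfolding co by simp
  have f0: "\<phi> (fvec j) (BE 1) = 0" "\<phi> (fvec j) BX = 0" if "1 \<le> j" "j \<le> k" for j
    using that img_f_e1_x_coord[OF iso, of j] by auto
  have e2: "eta (\<phi> (evec 2)) = - a\<^sup>2"
    unfolding img_e1_e1[OF iso, symmetric] eta_bracket co by (simp add: power2_eq_square)
  have "eta (\<phi> (evec 2) + \<phi> (fvec (k + 1))) = 0"
    using f0[of 1] k unfolding img_e1_f1[OF iso, symmetric] eta_bracket by simp
  then have fk1: "eta (\<phi> (fvec (k + 1))) = a\<^sup>2" by (simp only: eta_linear e2) simp
  have fkj: "eta (\<phi> (fvec (k + j))) = 0" if "2 \<le> j" "j \<le> k" for j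
    using f0[of j] that unfolding img_e1_f[OF iso that, symmetric] eta_bracket by simp
  have f1: "eta (\<phi> (fvec 1)) = 0"
  proof (rule descending_vanish[where m = k])
    show "eta (\<phi> (fvec k)) = 0"
      using f0[of k] k by (subst img_fk_x[OF iso, symmetric]) (simp only: eta_bracket, simp)
    show "eta (\<phi> (fvec i)) + eta (\<phi> (fvec (Suc i))) = 0" if "1 \<le> i" "i < k" for i
      using f0[of i] that unfolding eta_linear(1)[symmetric] img_f_x[OF iso that, symmetric]
      by (simp only: eta_bracket) simp
  qed (use k in auto)
  have tail: "(\<Sum>j=1..k. (-1)^(j - 1) * eta (\<phi> (fvec (k + j)))) = a\<^sup>2"
  proof -
    have "(\<Sum>j=1..k. (-1)^(j - 1) * eta (\<phi> (fvec (k + j)))) = (\<Sum>j=1..k. if j = 1 then a\<^sup>2 else 0)"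
    proof (intro sum.cong refl)
      fix j assume "j \<in> {1..k}"
      then consider "j = 1" | "2 \<le> j" "j \<le> k" by force
      then show "(-1)^(j - 1) * eta (\<phi> (fvec (k + j))) = (if j = 1 then a\<^sup>2 else 0)"
        by cases (simp_all only: fkj fk1, simp_all)
    qed
    then show ?thesis using k by simp
  qed
  have "a * \<alpha>' = a\<^sup>2 * \<alpha>"
    using arg_cong[OF img_e1_x[OF iso], of eta]
    unfolding eta_bracket eta_linear co f1 fk1 by (simp add: mult.commute)
  then have "\<alpha>' = a * \<alpha>" using a by (simp add: power2_eq_square)
  moreover have "a * \<beta>' = a\<^sup>2 * \<beta>"
    using arg_cong[OF img_x_e1[OF iso], of eta]
    unfolding eta_bracket eta_linear co f1 tail by (simp add: mult.commute)
  then have "\<beta>' = a * \<beta>" using a by (simp add: power2_eq_square)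
  moreover have "\<gamma>' = a\<^sup>2 * \<gamma>"
    using arg_cong[OF img_x_x[OF iso], of eta]
    unfolding eta_bracket eta_linear co fk1 by simp
  ultimately show ?thesis using a by blast
qed

end

theorem proposition4p7:
  fixes k n :: nat
  assumes "k \<ge> 2" and "n - 2 * k \<ge> 4"
  shows "(\<forall>\<alpha> \<beta> \<gamma>. \<exists>p\<in>canonical_params. R_mu2_1 k n (\<alpha>, \<beta>, \<gamma>) \<cong>\<^sub>L R_mu2_1 k n p) \<and>
         (\<forall>p\<in>canonical_params. \<forall>q\<in>canonical_params. p \<noteq> q \<longrightarrow> \<not> (R_mu2_1 k n p \<cong>\<^sub>L R_mu2_1 k n q))"
proof (intro conjI allI ballI impI notI)
  fix \<alpha> \<beta> \<gamma> :: complex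
  obtain c where "c \<noteq> 0" and c: "(c * \<alpha>, c * \<beta>, c\<^sup>2 * \<gamma>) \<in> canonical_params"
  proof -
    consider "\<alpha> \<noteq> 0" | "\<alpha> = 0" "\<beta> \<noteq> 0" | "\<alpha> = 0" "\<beta> = 0" "\<gamma> \<noteq> 0" | "\<alpha> = 0" "\<beta> = 0" "\<gamma> = 0"
      by blast
    then show thesis
    proof cases
      case 1
      then show thesis by (intro that[of "1 / \<alpha>"]) (auto simp: canonical_params_def)
    next
      case 2
      then show thesis by (intro that[of "1 / \<beta>"]) (auto simp: canonical_params_def)
    next
      case 3
      then show thesis by (intro that[of "1 / csqrt \<gamma>"]) (auto simp: canonical_params_def power_divide)
    next
      case 4
      then show thesis by (intro that[of 1]) (auto simp: canonical_params_def)
    qed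
  qed
  then show "\<exists>p\<in>canonical_params. R_mu2_1 k n (\<alpha>, \<beta>, \<gamma>) \<cong>\<^sub>L R_mu2_1 k n p"
    using isomorphic_rescale[OF assms] by blast
next
  fix p q assume pq: "p \<in> canonical_params" "q \<in> canonical_params" "p \<noteq> q"
    and "R_mu2_1 k n p \<cong>\<^sub>L R_mu2_1 k n q"
  moreover obtain \<alpha> \<beta> \<gamma> \<alpha>' \<beta>' \<gamma>' where "p = (\<alpha>, \<beta>, \<gamma>)" "q = (\<alpha>', \<beta>', \<gamma>')"
    by (metis prod_cases3)
  ultimately obtain c where "c \<noteq> 0" "q = (c * \<alpha>, c * \<beta>, c\<^sup>2 * \<gamma>)" "p = (\<alpha>, \<beta>, \<gamma>)"
    using iso_params[OF assms] unfolding isomorphic_def by blast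
  with pq show False by (auto simp: canonical_params_def)
qed

end
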